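(* Let $r\geq t\geq 3$ and $k\geq 2$. There is $N$ (depending on $r,t,k$) such that if $n_1\geq\cdots\geq n_r$ and $n_{t-1}\geq N$, then $${\rm ex}(n_1,\ldots,n_r,kK_t)=g(n_1,\ldots,n_r,k,t).$$ Moreover, every $kK_t$-free spanning subgraph of $K_{n_1,\ldots,n_r}$ with ${\rm ex}(n_1,\ldots,n_r,kK_t)$ edges is obtained from a $(t-1)$-partite spanning subgraph of $K_{n_1,\ldots,n_r}$ by adding all edges of $K_{n_1,\ldots,n_r}$ incident with some $k-1$ fixed vertices.
   Context: $K_{n_1,\ldots,n_r}$ is the complete $r$-partite graph with parts $V_1,\ldots,V_r$ of sizes $n_1,\ldots,n_r$. $kK_t$ is the vertex-disjoint union of $k$ copies of $K_t$. ${\rm ex}(n_1,\ldots,n_r,kK_t)$ is the maximum number of edges of a $kK_t$-free spanning subgraph of $K_{n_1,\ldots,n_r}$. Let $\mathcal{H}$ be the family of $(t-1)$-partite spanning subgraphs of $K_{n_1,\ldots,n_r}$ (vertex set partitionable into $t-1$ independent sets), and $\mathcal{H}^{k-1}$ the family of graphs obtained from some $H\in\mathcal{H}$ by adding all edges of $K_{n_1,\ldots,n_r}$ incident with $k-1$ fixed vertices. $g(n_1,\ldots,n_r,k,t)=\max\{e(F):F\in\mathcal{H}^{k-1}\}$. *)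

theory Defs
  imports Complex_Main "HOL-Library.Disjoint_Sets"
begin

text \<open>
  Finite simple undirected graphs: an edge is the set of its two endpoints. The type does not
  enforce this, but all graphs below are either built with edges of this kind or are subgraphs
  of such graphs.
\<close>

datatype 'a graph = Graph (verts: "'a set") (edges: "'a set set")

definition complete_graph :: "nat \<Rightarrow> nat graph" where
  "complete_graph t = Graph {..<t} {{a, b} | a b. a < t \<and> b < t \<and> a \<noteq> b}"

definition disjoint_copies :: "nat \<Rightarrow> 'a graph \<Rightarrow> (nat \<times> 'a) graph" where
  "disjoint_copies k G =
     Graph ({..<k} \<times> verts G) {Pair i ` e | i e. i < k \<and> e \<in> edges G}"

text \<open>The part sizes are \<open>n 1, \<dots>, n r\<close>; the part with index \<open>i\<close> is \<open>{i} \<times> {..<n i}\<close>.\<close>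

definition complete_multipartite :: "nat \<Rightarrow> (nat \<Rightarrow> nat) \<Rightarrow> (nat \<times> nat) graph" where
  "complete_multipartite r n =
     (let V = (SIGMA i:{1..r}. {..<n i})
      in Graph V {{u, v} | u v. u \<in> V \<and> v \<in> V \<and> fst u \<noteq> fst v})"

definition spanning_subgraph :: "'a graph \<Rightarrow> 'a graph \<Rightarrow> bool" where
  "spanning_subgraph F G \<longleftrightarrow> verts F = verts G \<and> edges F \<subseteq> edges G"

text \<open>Copies are subgraphs that need not be induced.\<close>

definition contains_copy :: "'a graph \<Rightarrow> 'b graph \<Rightarrow> bool" where
  "contains_copy G H \<longleftrightarrow>
     (\<exists>f. inj_on f (verts H) \<and> f ` verts H \<subseteq> verts G \<and> (\<forall>e\<in>edges H. f ` e \<in> edges G))"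

abbreviation free_of :: "'a graph \<Rightarrow> 'b graph \<Rightarrow> bool" where
  "free_of G H \<equiv> \<not> contains_copy G H"

definition ex_num :: "'a graph \<Rightarrow> 'b graph \<Rightarrow> nat" where
  "ex_num G H = Max {card (edges F) | F. spanning_subgraph F G \<and> free_of F H}"

definition independent_set :: "'a graph \<Rightarrow> 'a set \<Rightarrow> bool" where
  "independent_set G S \<longleftrightarrow> S \<subseteq> verts G \<and> (\<forall>u\<in>S. \<forall>v\<in>S. {u, v} \<notin> edges G)"

text \<open>Classes of the partition are allowed to be empty.\<close>

definition partite :: "nat \<Rightarrow> 'a graph \<Rightarrow> bool" where
  "partite m G \<longleftrightarrow>
     (\<exists>P. (\<Union>i<m. P i) = verts G \<and> disjoint_family_on P {..<m} \<and>
          (\<forall>i<m. independent_set G (P i)))"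

definition add_incident_edges :: "'a graph \<Rightarrow> 'a graph \<Rightarrow> 'a set \<Rightarrow> 'a graph" where
  "add_incident_edges G H S = Graph (verts H) (edges H \<union> {e \<in> edges G. e \<inter> S \<noteq> {}})"

text \<open>With \<open>G\<close> complete \<open>r\<close>-partite, these are the families \<open>\<H>\<close> and \<open>\<H>\<^sup>k\<^sup>-\<^sup>1\<close>.\<close>

definition partite_spanning :: "'a graph \<Rightarrow> nat \<Rightarrow> 'a graph set" where
  "partite_spanning G t = {H. spanning_subgraph H G \<and> partite (t - 1) H}"

definition partite_spanning_ext :: "'a graph \<Rightarrow> nat \<Rightarrow> nat \<Rightarrow> 'a graph set" where
  "partite_spanning_ext G k t =
     {add_incident_edges G H S | H S.
        H \<in> partite_spanning G t \<and> S \<subseteq> verts G \<and> card S = k - 1}"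

definition g_num :: "nat \<Rightarrow> (nat \<Rightarrow> nat) \<Rightarrow> nat \<Rightarrow> nat \<Rightarrow> nat" where
  "g_num r n k t =
     Max {card (edges F) | F. F \<in> partite_spanning_ext (complete_multipartite r n) k t}"

end

theory Submission
  imports Defs "HOL-Library.FuncSet"
begin

text \<open>
  Averaging over transversals: choose one vertex in every part and replace all vertices of a part by
  clones of the chosen one. This keeps \<open>K\<^sub>t\<close>-freeness, and the average number of edges of the
  resulting graph is the number of edges of the original graph. Hence for an extremal
  \<open>K\<^sub>t\<close>-free graph all these blow-ups are extremal, Zykov symmetrization makes
  nonadjacency transitive on vertices of distinct parts, and a \<open>(t - 1)\<close>-colouring can be read off
  from a single \<open>(t - 1)\<close>-clique.

  For \<open>k \<ge> 2\<close> it suffices, by induction on \<open>k\<close>, to find a vertex \<open>v\<close> of the extremal graph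
  \<open>F\<close> such that \<open>F - v\<close> contains no \<open>k - 1\<close> disjoint cliques. Suppose there is none. Let \<open>T\<close> consist
  of a maximal packing of cliques and of all small parts. Every \<open>v \<in> T\<close> is avoided by a packing
  \<open>W\<^sub>v\<close> of \<open>k - 1\<close> cliques, so every clique through \<open>v\<close> meets \<open>W\<^sub>v\<close>. Delete the
  edges inside \<open>T\<close>, keep \<open>T\<close> fixed, and average over transversals outside \<open>T\<close>: if the transversal
  avoids all \<open>W\<^sub>v\<close>, the blow-up is \<open>K\<^sub>t\<close>-free; otherwise it has \<open>O(m)\<close> edges too many, where \<open>m\<close>
  is the size of the \<open>(t - 1)\<close>-st largest part, but this is rare since the remaining parts
  are large. So \<open>F\<close> beats the extremal \<open>K\<^sub>t\<close>-free number by less than \<open>m\<close>. However, filling in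
  all edges at one vertex of a suitable extremal \<open>K\<^sub>t\<close>-free graph gains \<open>m\<close> edges without creating two
  disjoint cliques.
\<close>

subsection \<open>Clique packings in multipartite graphs\<close>

text \<open>Graphs are symmetric sets of ordered pairs, so cardinalities are twice the numbers of edges;
  \<open>p\<close> maps a vertex to its part.\<close>

definition cross_pairs :: "'a set \<Rightarrow> ('a \<Rightarrow> 'c) \<Rightarrow> ('a \<times> 'a) set" where
  "cross_pairs V p = {(u, v). u \<in> V \<and> v \<in> V \<and> p u \<noteq> p v}"

definition host_sub :: "'a set \<Rightarrow> ('a \<Rightarrow> 'c) \<Rightarrow> ('a \<times> 'a) set \<Rightarrow> bool" where
  "host_sub V p E \<longleftrightarrow> E \<subseteq> cross_pairs V p \<and> sym E"

definition part :: "'a set \<Rightarrow> ('a \<Rightarrow> 'c) \<Rightarrow> 'c \<Rightarrow> 'a set" where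
  "part V p i = {v \<in> V. p v = i}"

definition clique :: "('a \<times> 'a) set \<Rightarrow> 'a set \<Rightarrow> bool" where
  "clique E Q \<longleftrightarrow> (\<forall>u\<in>Q. \<forall>v\<in>Q. u \<noteq> v \<longrightarrow> (u, v) \<in> E)"

text \<open>Peeling off one \<open>t\<close>-clique at a time encodes \<open>k\<close>
  vertex-disjoint copies of \<open>K_t\<close> without a family of disjoint sets, so that packings
  can be handled by induction on \<open>k\<close>.\<close>

fun packs :: "nat \<Rightarrow> ('a \<times> 'a) set \<Rightarrow> nat \<Rightarrow> 'a set \<Rightarrow> bool" where
  "packs t E 0 V \<longleftrightarrow> True"
| "packs t E (Suc k) V \<longleftrightarrow> (\<exists>Q\<subseteq>V. card Q = t \<and> clique E Q \<and> packs t E k (V - Q))"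

definition extremal :: "'a set \<Rightarrow> ('a \<Rightarrow> 'c) \<Rightarrow> nat \<Rightarrow> nat \<Rightarrow> ('a \<times> 'a) set \<Rightarrow> bool" where
  "extremal V p t k E \<longleftrightarrow> host_sub V p E \<and> \<not> packs t E k V \<and>
     (\<forall>E'. host_sub V p E' \<and> \<not> packs t E' k V \<longrightarrow> card E' \<le> card E)"

definition star :: "'a set \<Rightarrow> ('a \<Rightarrow> 'c) \<Rightarrow> 'a \<Rightarrow> ('a \<times> 'a) set" where
  "star V p v = {(u, w) \<in> cross_pairs V p. u = v \<or> w = v}"

text \<open>The blow-up in which every vertex \<open>v\<close> becomes a clone of
  \<open>\<phi> v\<close>. Only pairs from distinct parts are kept, so it stays inside the complete
  multipartite graph.\<close>

definition pullback :: "'a set \<Rightarrow> ('a \<Rightarrow> 'c) \<Rightarrow> ('a \<Rightarrow> 'a) \<Rightarrow> ('a \<times> 'a) set \<Rightarrow> ('a \<times> 'a) set"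
  where "pullback V p \<phi> E = {(u, v) \<in> cross_pairs V p. (\<phi> u, \<phi> v) \<in> E}"

text \<open>Vertices of \<open>T\<close> stay untouched, so representatives are chosen outside
  \<open>T\<close> only. The extensional function space has exactly one function for each choice,
  which the counting below relies on.\<close>

definition transversals :: "'a set \<Rightarrow> ('a \<Rightarrow> 'c) \<Rightarrow> 'a set \<Rightarrow> ('c \<Rightarrow> 'a) set" where
  "transversals V p T = PiE (p ` (V - T)) (part (V - T) p)"

definition collapse :: "('a \<Rightarrow> 'c) \<Rightarrow> 'a set \<Rightarrow> ('c \<Rightarrow> 'a) \<Rightarrow> 'a \<Rightarrow> 'a" where
  "collapse p T x v = (if v \<in> T then v else x (p v))"

lemma finite_cross_pairs: "finite V \<Longrightarrow> finite (cross_pairs V p)"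
  by (rule finite_subset[of _ "V \<times> V"]) (auto simp: cross_pairs_def)

lemma host_sub_finite: "finite V \<Longrightarrow> host_sub V p E \<Longrightarrow> finite E"
  by (auto simp: host_sub_def intro: finite_subset finite_cross_pairs)

lemma host_subD: "host_sub V p E \<Longrightarrow> (u, v) \<in> E \<Longrightarrow> u \<in> V \<and> v \<in> V \<and> p u \<noteq> p v \<and> (v, u) \<in> E"
  by (auto simp: host_sub_def cross_pairs_def sym_def)

lemma star_sub: "host_sub V p (star V p v)"
  by (auto simp: host_sub_def star_def cross_pairs_def sym_def)

lemma host_sub_Un: "host_sub V p E \<Longrightarrow> host_sub V p F \<Longrightarrow> host_sub V p (E \<union> F)"
  by (auto simp: host_sub_def sym_Un)

lemma clique_subset: "clique E Q \<Longrightarrow> R \<subseteq> Q \<Longrightarrow> clique E R"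
  by (auto simp: clique_def)

lemma clique_inj_on: "host_sub V p E \<Longrightarrow> clique E Q \<Longrightarrow> inj_on p Q"
  unfolding clique_def inj_on_def by (metis host_subD)

lemma packs_one: "packs t E 1 V \<longleftrightarrow> (\<exists>Q\<subseteq>V. card Q = t \<and> clique E Q)"
  by simp

section \<open>Basic operations on packings of disjoint cliques\<close>

lemma packs_mono:
  assumes "packs t E k V" "V \<subseteq> V'" "\<And>u v. u \<in> V \<Longrightarrow> v \<in> V \<Longrightarrow> (u, v) \<in> E \<Longrightarrow> (u, v) \<in> E'"
  shows "packs t E' k V'"
  using assms
proof (induction k arbitrary: V V')
  case (Suc k)
  then obtain Q where Q: "Q \<subseteq> V" "card Q = t" "clique E Q" "packs t E k (V - Q)" by auto
  have "packs t E' k (V' - Q)"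
    using Suc.prems by (intro Suc.IH[OF Q(4)]) auto
  moreover have "clique E' Q" using Q Suc.prems(3) unfolding clique_def by blast
  ultimately show ?case using Q Suc.prems(2) by auto
qed simp

text \<open>A vertex lies in at most one clique of a packing, so deleting it destroys at most one of
  them.\<close>

lemma packs_remove: "packs t E (Suc k) V \<Longrightarrow> packs t E k (V - {v})"
proof (induction k arbitrary: V)
  case (Suc k)
  then obtain Q where Q: "Q \<subseteq> V" "card Q = t" "clique E Q" "packs t E (Suc k) (V - Q)"
    by (auto simp del: packs.simps(2) simp: packs.simps(2)[of t E "Suc k" V])
  show ?case
  proof (cases "v \<in> Q")
    case True
    then show ?thesis by (intro packs_mono[OF Q(4)]) auto
  next
    case False
    have "packs t E k (V - Q - {v})" by (rule Suc.IH[OF Q(4)])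
    moreover have "V - Q - {v} = V - {v} - Q" by blast
    ultimately have "packs t E k (V - {v} - Q)" by simp
    then show ?thesis using Q False by auto
  qed
qed simp

lemma packs_vertices:
  assumes "packs t E k V" "t > 0"
  shows "\<exists>W\<subseteq>V. finite W \<and> card W = k * t \<and> packs t E k W"
  using assms(1)
proof (induction k arbitrary: V)
  case (Suc k)
  then obtain Q where Q: "Q \<subseteq> V" "card Q = t" "clique E Q" "packs t E k (V - Q)" by auto
  from Suc.IH[OF Q(4)] obtain W where W: "W \<subseteq> V - Q" "finite W" "card W = k * t" "packs t E k W"
    by blast
  have "finite Q" using Q assms(2) by (metis card.infinite less_irrefl)
  then have "card (Q \<union> W) = Suc k * t" using W Q by (subst card_Un_disjoint) auto
  moreover have "packs t E (Suc k) (Q \<union> W)"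
  proof -
    have "packs t E k (Q \<union> W - Q)" by (rule packs_mono[OF W(4)]) (use W in auto)
    then show ?thesis using Q by auto
  qed
  ultimately show ?case using Q W \<open>finite Q\<close> by (intro exI[of _ "Q \<union> W"]) auto
qed auto

text \<open>The cover is the vertex set of a greedily built maximal packing: it consists of at most
  \<open>k\<close> cliques, and no clique remains outside it.\<close>

lemma packing_cover:
  assumes "\<not> packs t E (Suc k) V" "t > 0"
  shows "\<exists>T\<subseteq>V. finite T \<and> card T \<le> k * t \<and> \<not> packs t E 1 (V - T)"
  using assms(1)
proof (induction k arbitrary: V)
  case 0
  then show ?case by (intro exI[of _ "{}"]) auto
next
  case (Suc k)
  show ?case
  proof (cases "packs t E 1 V")
    case True
    then obtain Q where Q: "Q \<subseteq> V" "card Q = t" "clique E Q" unfolding packs_one by blast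
    then have "\<not> packs t E (Suc k) (V - Q)" using Suc.prems by (subst (asm) packs.simps(2)) blast
    from Suc.IH[OF this] obtain T where
      T: "T \<subseteq> V - Q" "finite T" "card T \<le> k * t" "\<not> packs t E 1 (V - Q - T)" by blast
    have "finite Q" using Q assms(2) by (metis card.infinite less_irrefl)
    moreover have "card (Q \<union> T) \<le> Suc k * t" using card_Un_le[of Q T] T Q by simp
    moreover have "V - (Q \<union> T) = V - Q - T" by blast
    ultimately show ?thesis using T Q by (intro exI[of _ "Q \<union> T"]) auto
  qed (auto intro!: exI[of _ "{}"])
qed

text \<open>At most one clique of a packing contains \<open>v\<close>; the others live in
  \<open>V - {v}\<close>, where the star adds no edges.\<close>

lemma packs_star:
  assumes "\<not> packs t E k (V - {v})"
  shows "\<not> packs t (E \<union> star V p v) (Suc k) V"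
proof
  assume "packs t (E \<union> star V p v) (Suc k) V"
  from packs_remove[OF this, of v] have "packs t E k (V - {v})"
    by (rule packs_mono) (auto simp: star_def)
  with assms show False ..
qed

lemma extremalD:
  assumes "extremal V p t k E"
  shows "host_sub V p E" "\<not> packs t E k V"
    and "\<And>E'. host_sub V p E' \<Longrightarrow> \<not> packs t E' k V \<Longrightarrow> card E' \<le> card E"
  using assms by (simp_all add: extremal_def)

lemma extremal_exists:
  assumes "finite V" "t \<ge> 2" "k > 0"
  shows "\<exists>E. extremal V p t k E"
proof -
  let ?P = "\<lambda>E. host_sub V p E \<and> \<not> packs t E k V"
  \<comment> \<open>The empty graph is feasible: as \<open>t \<ge> 2\<close>, a
    \<open>t\<close>-clique needs an edge.\<close>
  have "\<not> clique {} Q" if "card Q = t" for Q :: "'a set"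
  proof
    assume "clique {} Q"
    then have "\<forall>u\<in>Q. \<forall>v\<in>Q. u = v" by (auto simp: clique_def)
    then have "card Q \<le> 1" by (metis card.infinite card_le_Suc0_iff_eq One_nat_def zero_le)
    with that assms show False by simp
  qed
  then have "?P {}" using \<open>k > 0\<close> by (cases k) (auto simp: host_sub_def sym_def)
  moreover have "\<forall>E. ?P E \<longrightarrow> card E < Suc (card (cross_pairs V p))"
    using card_mono[OF finite_cross_pairs[OF assms(1)]] by (auto simp: host_sub_def less_Suc_eq_le)
  ultimately have "\<exists>E. ?P E \<and> (\<forall>E'. ?P E' \<longrightarrow> card E' \<le> card E)"
    by (rule ex_has_greatest_nat)
  then show ?thesis by (simp add: extremal_def conj_assoc)
qed

subsection \<open>Collapsing parts onto transversals\<close>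

lemma pullback_host_sub: "sym E \<Longrightarrow> host_sub V p (pullback V p \<phi> E)"
  by (auto simp: pullback_def host_sub_def cross_pairs_def sym_def)

text \<open>\<open>E\<close> has no loops, so two clones of one vertex are never adjacent, and a
  clique of the blow-up maps injectively onto a clique of \<open>E\<close>.\<close>

lemma clique_pullback:
  assumes "host_sub V p E" "clique (pullback V p \<phi> E) Q"
  shows "inj_on \<phi> Q" "clique E (\<phi> ` Q)"
proof -
  have *: "(\<phi> u, \<phi> v) \<in> E" if "u \<in> Q" "v \<in> Q" "u \<noteq> v" for u v
    using assms(2) that by (auto simp: clique_def pullback_def)
  show "inj_on \<phi> Q"
    by (rule inj_onI) (metis * assms(1) host_subD)
  show "clique E (\<phi> ` Q)" using * by (auto simp: clique_def)
qed

lemma pullback_free: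
  assumes "host_sub V p E" "\<not> packs t E 1 V" "\<phi> ` V \<subseteq> V"
  shows "\<not> packs t (pullback V p \<phi> E) 1 V"
proof
  assume "packs t (pullback V p \<phi> E) 1 V"
  then obtain Q where Q: "Q \<subseteq> V" "card Q = t" "clique (pullback V p \<phi> E) Q"
    unfolding packs_one by blast
  from clique_pullback[OF assms(1) Q(3)] have "card (\<phi> ` Q) = t" "clique E (\<phi> ` Q)"
    using Q by (auto simp: card_image)
  moreover have "\<phi> ` Q \<subseteq> V" using Q assms by blast
  ultimately show False using assms(2) unfolding packs_one by blast
qed

lemma transversals_mem:
  "x \<in> transversals V p T \<Longrightarrow> v \<in> V - T \<Longrightarrow> x (p v) \<in> V - T \<and> p (x (p v)) = p v"
  unfolding transversals_def part_def by (drule PiE_mem[of _ _ _ "p v"]) auto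

lemma finite_transversals: "finite V \<Longrightarrow> finite (transversals V p T)"
  by (auto simp: transversals_def part_def intro!: finite_PiE)

lemma transversals_through:
  assumes "A \<subseteq> V - T" "inj_on p A"
  shows "\<exists>x\<in>transversals V p T. \<forall>a\<in>A. x (p a) = a"
proof -
  define x where "x = (\<lambda>i\<in>p ` (V - T). if i \<in> p ` A then inv_into A p i else inv_into (V - T) p i)"
  have "x \<in> transversals V p T"
    unfolding transversals_def
  proof (rule PiE_I)
    fix i assume i: "i \<in> p ` (V - T)"
    show "x i \<in> part (V - T) p i"
      using i assms(1) inv_into_into[of i p A] inv_into_into[OF i] f_inv_into_f[of i p A]
        f_inv_into_f[OF i] by (auto simp: x_def part_def)
  qed (simp add: x_def)
  moreover have "\<forall>a\<in>A. x (p a) = a"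
    using assms by (auto simp: x_def)
  ultimately show ?thesis by blast
qed

lemma collapse_facts:
  assumes "x \<in> transversals V p T" "T \<subseteq> V" "v \<in> V"
  shows "collapse p T x v \<in> V" "p (collapse p T x v) = p v" "collapse p T x v \<in> T \<longleftrightarrow> v \<in> T"
  using transversals_mem[OF assms(1), of v] assms by (auto simp: collapse_def)

text \<open>Exchanging \<open>u\<close>, \<open>v\<close> with the representatives of their parts is an involution; it shows that
  the collapse of a fixed vertex pair is equidistributed over its pair of parts.\<close>

lemma sum_collapse:
  fixes h :: "'a \<Rightarrow> 'a \<Rightarrow> nat"
  assumes "T \<subseteq> V"
  shows "(\<Sum>(x, u, v)\<in>transversals V p T \<times> cross_pairs V p. h (collapse p T x u) (collapse p T x v))
       = (\<Sum>(x, u, v)\<in>transversals V p T \<times> cross_pairs V p. h u v)"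
proof -
  let ?X = "transversals V p T" and ?K = "cross_pairs V p"
  \<comment> \<open>\<open>upd x u v\<close> makes \<open>u\<close> and \<open>v\<close> the
    representatives of their parts, except that a vertex of \<open>T\<close>, being fixed by the
    collapse, changes nothing.\<close>
  define upd where "upd = (\<lambda>x u v i. if u \<notin> T \<and> i = p u then u else if v \<notin> T \<and> i = p v then v
    else (x i :: 'a))"
  define \<sigma> where "\<sigma> = (\<lambda>(x, u, v). (upd x u v, collapse p T x u, collapse p T x v))"
  have mem: "\<sigma> a \<in> ?X \<times> ?K" if "a \<in> ?X \<times> ?K" for a
  proof -
    obtain x u v where a: "a = (x, u, v)" by (cases a)
    have x: "x \<in> ?X" and uv: "u \<in> V" "v \<in> V" "p u \<noteq> p v"
      using that by (auto simp: a cross_pairs_def)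
    have "upd x u v \<in> ?X"
      using x uv by (auto simp: upd_def transversals_def PiE_iff part_def extensional_def)
    then show ?thesis
      using collapse_facts[OF x assms] uv by (auto simp: a \<sigma>_def cross_pairs_def)
  qed
  have invol: "\<sigma> (\<sigma> a) = a" if "a \<in> ?X \<times> ?K" for a
  proof -
    obtain x u v where a: "a = (x, u, v)" by (cases a)
    have x: "x \<in> ?X" and uv: "u \<in> V" "v \<in> V" "p u \<noteq> p v"
      using that by (auto simp: a cross_pairs_def)
    note c = collapse_facts[OF x assms uv(1)] collapse_facts[OF x assms uv(2)]
    have "upd (upd x u v) (collapse p T x u) (collapse p T x v) = x"
      using c uv by (auto simp: upd_def collapse_def fun_eq_iff)
    moreover have "collapse p T (upd x u v) (collapse p T x u) = u"
      "collapse p T (upd x u v) (collapse p T x v) = v"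
      using c uv by (auto simp: upd_def collapse_def)
    ultimately show ?thesis by (simp add: a \<sigma>_def)
  qed
  show ?thesis
    by (rule sum.reindex_bij_witness[of _ \<sigma> \<sigma>]) (use mem invol in \<open>auto simp: \<sigma>_def\<close>)
qed

text \<open>Double counting: the sum of the arc counts is a sum over transversals and ordered pairs,
  and \<open>sum_collapse\<close> applies to the indicator of \<open>E\<close>. Hence the average
  blow-up has exactly as many arcs as \<open>E\<close>.\<close>

lemma sum_card_pullback:
  assumes "finite V" "T \<subseteq> V" "E \<subseteq> cross_pairs V p"
  shows "(\<Sum>x\<in>transversals V p T. card (pullback V p (collapse p T x) E))
       = card (transversals V p T) * card E"
proof -
  let ?X = "transversals V p T" and ?K = "cross_pairs V p"
  have fin: "finite ?K" "finite ?X" by (simp_all add: assms finite_cross_pairs finite_transversals)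
  define h :: "'a \<Rightarrow> 'a \<Rightarrow> nat" where "h u v = of_bool ((u, v) \<in> E)" for u v
  have "card (pullback V p (collapse p T x) E)
      = (\<Sum>(u, v)\<in>?K. h (collapse p T x u) (collapse p T x v))" for x
  proof -
    have "pullback V p (collapse p T x) E
        = ?K \<inter> {a. (collapse p T x (fst a), collapse p T x (snd a)) \<in> E}"
      by (auto simp: pullback_def)
    then show ?thesis by (simp add: h_def fin sum.If_cases case_prod_unfold of_bool_def)
  qed
  then have "(\<Sum>x\<in>?X. card (pullback V p (collapse p T x) E)) =
     (\<Sum>(x, u, v)\<in>?X \<times> ?K. h (collapse p T x u) (collapse p T x v))"
    by (simp add: sum.cartesian_product)
  also have "\<dots> = (\<Sum>(x, u, v)\<in>?X \<times> ?K. h u v)" by (rule sum_collapse[OF assms(2)])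
  also have "\<dots> = (\<Sum>x\<in>?X. \<Sum>(u, v)\<in>?K. h u v)" by (rule sum.cartesian_product[symmetric])
  also have "(\<Sum>(u, v)\<in>?K. h u v) = card E"
  proof -
    have "E = ?K \<inter> {a. (fst a, snd a) \<in> E}" using assms(3) by auto
    then show ?thesis by (simp add: h_def fin sum.If_cases case_prod_unfold of_bool_def)
  qed
  finally show ?thesis by simp
qed

text \<open>The representative of one part can be redrawn independently of all others, so each
  vertex of that part outside \<open>T\<close> represents it in equally many transversals.\<close>

lemma card_transversals_through:
  assumes "w \<in> V - T"
  shows "card {x \<in> transversals V p T. x (p w) = w} * card (part (V - T) p (p w))
       = card (transversals V p T)"
proof -
  let ?X = "transversals V p T" and ?C = "part (V - T) p (p w)"
  have w: "w \<in> ?C" "p w \<in> p ` (V - T)" using assms by (auto simp: part_def)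
  have "bij_betw (\<lambda>(x, u). x(p w := u)) ({x \<in> ?X. x (p w) = w} \<times> ?C) ?X"
  proof (rule bij_betw_byWitness[where f' = "\<lambda>x. (x(p w := w), x (p w))"])
    show "(\<lambda>(x, u). x(p w := u)) ` ({x \<in> ?X. x (p w) = w} \<times> ?C) \<subseteq> ?X"
      using w by (auto simp: transversals_def PiE_iff extensional_def)
    show "(\<lambda>x. (x(p w := w), x (p w))) ` ?X \<subseteq> {x \<in> ?X. x (p w) = w} \<times> ?C"
      using w by (auto simp: transversals_def PiE_iff extensional_def)
  qed (auto simp: fun_eq_iff)
  from bij_betw_same_card[OF this] show ?thesis by (simp add: card_cartesian_product)
qed

subsection \<open>Extremal clique-free graphs\<close>

text \<open>Every collapse is again \<open>K_t\<close>-free and so has at most \<open>card E\<close>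
  arcs, while the average is exactly \<open>card E\<close>; hence none falls short.\<close>

lemma extremal_pullback:
  assumes "finite V" "extremal V p t 1 E" "x \<in> transversals V p {}"
  shows "extremal V p t 1 (pullback V p (\<lambda>v. x (p v)) E)"
proof -
  let ?X = "transversals V p {}" and ?F = "\<lambda>x. pullback V p (\<lambda>v. x (p v)) E"
  note E = extremalD[OF assms(2)]
  have sub: "host_sub V p (?F y)" for y
    using E(1) by (intro pullback_host_sub) (simp add: host_sub_def)
  have free: "\<not> packs t (?F y) 1 V" if "y \<in> ?X" for y
    using transversals_mem[OF that] by (intro pullback_free E) auto
  have le: "card (?F y) \<le> card E" if "y \<in> ?X" for y
    by (intro E sub free that)
  have "collapse p {} y = (\<lambda>v. y (p v))" for y :: "'b \<Rightarrow> 'a" by (simp add: collapse_def fun_eq_iff)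
  then have "(\<Sum>y\<in>?X. card (?F y)) = (\<Sum>y\<in>?X. card E)"
    using sum_card_pullback[OF assms(1), of "{}" E p] E(1) by (simp add: host_sub_def)
  then have "card (?F x) = card E"
    using sum_mono_inv[of "\<lambda>y. card (?F y)" ?X "\<lambda>_. card E"] le finite_transversals[OF assms(1)] assms(3)
    by blast
  then show ?thesis using E sub free[OF assms(3)] unfolding extremal_def by simp
qed

text \<open>Zykov symmetrization: the vertices of \<open>A\<close> become clones of \<open>b\<close>.\<close>

lemma extremal_clone:
  assumes "finite V" "extremal V p t 1 D" "A \<subseteq> V" "b \<in> V - A"
    and no_loss: "\<And>a w. a \<in> A \<Longrightarrow> w \<in> V \<Longrightarrow> p w = p a \<Longrightarrow> (b, w) \<notin> D"
  shows "2 * (card A * card (D `` {b})) \<le> card (D - ((- A) \<times> (- A)))"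
proof -
  define \<phi> where "\<phi> v = (if v \<in> A then b else v)" for v
  note D = extremalD[OF assms(2)]
  note Dd = host_subD[OF D(1)]
  have fin: "finite D" "finite A" "finite (D `` {b})"
    using host_sub_finite[OF assms(1) D(1)] finite_subset[OF assms(3,1)] by auto
  have "card (pullback V p \<phi> D) \<le> card D"
    by (intro D pullback_host_sub pullback_free)
      (use D(1) assms(3,4) in \<open>auto simp: host_sub_def \<phi>_def\<close>)
  moreover have "D \<inter> ((- A) \<times> (- A)) \<union> (A \<times> D `` {b} \<union> D `` {b} \<times> A) \<subseteq> pullback V p \<phi> D"
  proof -
    \<comment> \<open>Neighbours of \<open>b\<close> lie outside all parts that meet
      \<open>A\<close>, so the clones lose no edge to the multipartite constraint.\<close>
    have away: "w \<notin> A \<and> w \<in> V \<and> p w \<noteq> p a" if "a \<in> A" "(b, w) \<in> D" for a w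
      using no_loss[of a w] no_loss[of w w] Dd[OF that(2)] that by auto
    have "(a, w) \<in> pullback V p \<phi> D \<and> (w, a) \<in> pullback V p \<phi> D"
      if "a \<in> A" "(b, w) \<in> D" for a w
      using that away[OF that] Dd[OF that(2)] assms(3)
      by (auto simp: pullback_def \<phi>_def cross_pairs_def)
    moreover have "(u, w) \<in> pullback V p \<phi> D" if "(u, w) \<in> D" "u \<notin> A" "w \<notin> A" for u w
      using that Dd[OF that(1)] by (auto simp: pullback_def \<phi>_def cross_pairs_def)
    ultimately show ?thesis by blast
  qed
  moreover have "finite (pullback V p \<phi> D)"
    by (rule host_sub_finite[OF assms(1) pullback_host_sub]) (use D(1) in \<open>auto simp: host_sub_def\<close>)
  ultimately have "card (D \<inter> ((- A) \<times> (- A)) \<union> (A \<times> D `` {b} \<union> D `` {b} \<times> A)) \<le> card D"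
    by (meson card_mono le_trans)
  moreover have "D `` {b} \<inter> A = {}" using no_loss assms(3) by blast
  then have "card (D \<inter> ((- A) \<times> (- A)) \<union> (A \<times> D `` {b} \<union> D `` {b} \<times> A))
      = card (D \<inter> ((- A) \<times> (- A))) + (card A * card (D `` {b}) + card (D `` {b}) * card A)"
    using fin by (subst card_Un_disjoint; (subst card_Un_disjoint)?) (auto simp: card_cartesian_product)
  moreover have "card D = card (D \<inter> ((- A) \<times> (- A))) + card (D - ((- A) \<times> (- A)))"
    using fin card_Int_Diff by blast
  ultimately show ?thesis by (simp add: mult.commute)
qed

text \<open>After collapsing onto a transversal through the three vertices, nonadjacency holds
  between whole parts, so cloning applies. Cloning one vertex as another shows that the three
  degrees are equal. Turning both \<open>a\<close> and \<open>c\<close> into clones of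
  \<open>b\<close> would then gain: the edge \<open>ac\<close> counts in both degrees but is lost
  only once.\<close>

lemma extremal_nonadj_trans:
  assumes "finite V" "extremal V p t 1 E" "a \<in> V" "b \<in> V" "c \<in> V"
    and "p a \<noteq> p b" "p b \<noteq> p c" "p a \<noteq> p c" "(a, b) \<notin> E" "(b, c) \<notin> E"
  shows "(a, c) \<notin> E"
proof
  assume ac: "(a, c) \<in> E"
  have "\<exists>x\<in>transversals V p {}. \<forall>a\<in>{a, b, c}. x (p a) = a"
    using assms by (intro transversals_through) (auto simp: inj_on_def)
  then obtain x where x: "x \<in> transversals V p {}" "x (p a) = a" "x (p b) = b" "x (p c) = c"
    by auto
  define D where "D = pullback V p (\<lambda>v. x (p v)) E"
  have ext: "extremal V p t 1 D" unfolding D_def by (rule extremal_pullback[OF assms(1,2) x(1)])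
  have sE: "sym E" using assms(2) by (auto simp: extremal_def host_sub_def)
  have sub: "host_sub V p D" using ext by (simp add: extremal_def)
  note Dd = host_subD[OF sub]
  have hom: "(u, w) \<in> D \<longleftrightarrow> u \<in> V \<and> w \<in> V \<and> p u \<noteq> p w \<and> (x (p u), x (p w)) \<in> E" for u w
    by (auto simp: D_def pullback_def cross_pairs_def)
  have non: "(u, w) \<notin> D" if "{p u, p w} \<in> {{p a, p b}, {p b, p c}}" for u w
    using that assms(9,10) x sE by (auto simp: hom doubleton_eq_iff dest: symD)
  have acD: "(a, c) \<in> D" "(c, a) \<in> D" using ac assms x sE by (auto simp: hom dest: symD)
  have fin: "finite D" by (rule host_sub_finite[OF assms(1) sub])
  let ?d = "\<lambda>v. card (D `` {v})"
  have finN: "finite (D `` {v})" for v using fin by simp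
  have deg: "?d u \<le> ?d w" if "u \<in> V" "w \<in> V" "u \<noteq> w" "{p u, p w} \<in> {{p a, p b}, {p b, p c}}" for u w
  proof -
    have "2 * (card {w} * ?d u) \<le> card (D - ((- {w}) \<times> (- {w})))"
      using that by (intro extremal_clone[OF assms(1) ext] non) auto
    also have "\<dots> \<le> card ({w} \<times> D `` {w} \<union> D `` {w} \<times> {w})"
      using Dd finN by (intro card_mono) auto
    also have "\<dots> \<le> 2 * ?d w"
      using card_Un_le[of "{w} \<times> D `` {w}" "D `` {w} \<times> {w}"] by (simp add: card_cartesian_product)
    finally show ?thesis by simp
  qed
  have "a \<noteq> b" "b \<noteq> c" "a \<noteq> c" using assms by auto
  then have eq: "?d a = ?d b" "?d c = ?d b"
    using assms deg by (auto intro!: antisym deg simp: insert_commute)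
  have pos: "?d a > 0" "?d c > 0" using acD finN by (auto simp: card_gt_0_iff)
  have "2 * (card {a, c} * ?d b) \<le> card (D - ((- {a, c}) \<times> (- {a, c})))"
    using assms \<open>a \<noteq> b\<close> \<open>b \<noteq> c\<close> by (intro extremal_clone[OF assms(1) ext] non) auto
  also have "\<dots> \<le> card (({a} \<times> D `` {a} \<union> {c} \<times> D `` {c}) \<union>
      ((D `` {a} - {c}) \<times> {a} \<union> (D `` {c} - {a}) \<times> {c}))"
    using Dd finN acD by (intro card_mono) auto
  also have "\<dots> \<le> (?d a + ?d c) + ((?d a - 1) + (?d c - 1))"
  proof -
    have "card ({a} \<times> D `` {a} \<union> {c} \<times> D `` {c}) \<le> ?d a + ?d c"
      using card_Un_le[of "{a} \<times> D `` {a}" "{c} \<times> D `` {c}"] by (simp add: card_cartesian_product)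
    moreover have "card ((D `` {a} - {c}) \<times> {a} \<union> (D `` {c} - {a}) \<times> {c}) \<le> (?d a - 1) + (?d c - 1)"
      using card_Un_le[of "(D `` {a} - {c}) \<times> {a}" "(D `` {c} - {a}) \<times> {c}"] acD finN
      by (simp add: card_cartesian_product)
    ultimately show ?thesis by (meson add_mono card_Un_le le_trans)
  qed
  finally show False using eq pos \<open>a \<noteq> c\<close> by simp
qed

text \<open>If the representatives contain no \<open>(t - 1)\<close>-clique, neither does the
  collapsed graph, so filling in the star of any vertex creates no \<open>t\<close>-clique.
  Extremality then forces the collapsed graph to be complete multipartite, and with at least
  \<open>t - 1\<close> parts it does contain a \<open>(t - 1)\<close>-clique.\<close>

lemma transversal_has_clique:
  assumes "finite V" "extremal V p t 1 E" "t > 0" "t - 1 \<le> card (p ` V)" "x \<in> transversals V p {}"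
  shows "\<exists>Q\<subseteq>x ` p ` V. card Q = t - 1 \<and> clique E Q"
proof (rule ccontr)
  assume none: "\<not> ?thesis"
  have xm: "x (p v) \<in> V" "p (x (p v)) = p v" if "v \<in> V" for v
    using transversals_mem[OF assms(5), of v] that by auto
  define D where "D = pullback V p (\<lambda>v. x (p v)) E"
  have ext: "extremal V p t 1 D" unfolding D_def by (rule extremal_pullback[OF assms(1,2,5)])
  have sub: "host_sub V p D" and subE: "host_sub V p E" using ext assms(2) by (simp_all add: extremal_def)
  have free: "\<not> clique D Q" if "Q \<subseteq> V" "card Q = t - 1" for Q
  proof
    assume "clique D Q"
    from clique_pullback[OF subE this[unfolded D_def]]
    have "card ((\<lambda>v. x (p v)) ` Q) = t - 1" "clique E ((\<lambda>v. x (p v)) ` Q)"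
      using that by (auto simp: card_image)
    moreover have "(\<lambda>v. x (p v)) ` Q \<subseteq> x ` p ` V" using that by auto
    ultimately show False using none by blast
  qed
  show False
  proof (cases "cross_pairs V p \<subseteq> D")
    case True
    have "inj_on x (p ` V)" by (intro inj_onI) (metis imageE xm(2))
    then have "t - 1 \<le> card (x ` p ` V)" using assms by (simp add: card_image)
    then obtain Q where Q: "Q \<subseteq> x ` p ` V" "card Q = t - 1"
      by (meson obtain_subset_with_card_n)
    have Qx: "u \<in> V" "x (p u) = u" if "u \<in> Q" for u using Q(1) that xm by auto
    have "clique D Q"
      unfolding clique_def
    proof (intro ballI impI)
      fix u w assume uw: "u \<in> Q" "w \<in> Q" "u \<noteq> w"
      then have "p u \<noteq> p w" using Qx(2) by metis
      then show "(u, w) \<in> D" using True Qx(1) uw by (auto simp: cross_pairs_def)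
    qed
    moreover have "Q \<subseteq> V" using Qx by auto
    ultimately show False using free Q by blast
  next
    case False
    then obtain a b where ab: "(a, b) \<in> cross_pairs V p" "(a, b) \<notin> D" by auto
    let ?D = "D \<union> star V p a"
    have "\<not> packs t ?D 1 V"
    proof
      assume "packs t ?D 1 V"
      then obtain Q where Q: "Q \<subseteq> V" "card Q = t" "clique ?D Q" unfolding packs_one by blast
      have "t - 1 \<le> card (Q - {a})" using Q by (cases "a \<in> Q") auto
      then obtain R where R: "R \<subseteq> Q - {a}" "card R = t - 1" by (meson obtain_subset_with_card_n)
      then have "clique D R" using Q(3) by (auto simp: clique_def star_def)
      then show False using free[of R] R Q by blast
    qed
    moreover have s: "host_sub V p ?D" by (intro host_sub_Un sub star_sub)
    ultimately have "card ?D \<le> card D" using ext by (auto simp: extremal_def)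
    moreover have "D \<subset> ?D" using ab by (auto simp: star_def)
    ultimately show False using psubset_card_mono[OF host_sub_finite[OF assms(1) s]] by fastforce
  qed
qed

section \<open>Reading off a colouring from a single clique\<close>

definition colorable :: "nat \<Rightarrow> 'a set \<Rightarrow> ('a \<times> 'a) set \<Rightarrow> bool" where
  "colorable s V E \<longleftrightarrow> (\<exists>q. \<forall>u\<in>V. q u < s \<and> (\<forall>v\<in>V. (u, v) \<in> E \<longrightarrow> q u \<noteq> q v))"

lemma colorableI:
  assumes "finite C" "card C = s" "\<And>u. u \<in> V \<Longrightarrow> f u \<in> C"
    and "\<And>u v. u \<in> V \<Longrightarrow> v \<in> V \<Longrightarrow> (u, v) \<in> E \<Longrightarrow> f u \<noteq> f v"
  shows "colorable s V E"
proof -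
  obtain h where h: "bij_betw h C {0..<s}" using ex_bij_betw_finite_nat[OF assms(1)] assms(2) by auto
  then have "inj_on h C" "\<And>c. c \<in> C \<Longrightarrow> h c < s" by (auto simp: bij_betw_def)
  with assms show ?thesis
    unfolding colorable_def by (intro exI[of _ "h \<circ> f"]) (auto simp: inj_on_eq_iff)
qed

lemma clique_insert_iff:
  assumes "host_sub V p E"
  shows "clique E (insert v Q) \<longleftrightarrow> clique E Q \<and> (\<forall>w\<in>Q. w \<noteq> v \<longrightarrow> (v, w) \<in> E)"
  using host_subD[OF assms] by (auto simp: clique_def)

text \<open>Each vertex is coloured by a vertex of a fixed \<open>(t - 1)\<close>-clique
  \<open>C\<close>: by the one in another part to which it is not adjacent or, failing that, by the
  one in its own part. Transitivity of nonadjacency makes the former unique, and the absence of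
  \<open>t\<close>-cliques provides the latter. The delicate case is an edge between vertices
  coloured by different rules.\<close>

lemma extremal_one_colorable:
  assumes "finite V" "extremal V p t 1 E" "t \<ge> 2" "t - 1 \<le> card (p ` V)"
  shows "colorable (t - 1) V E"
proof -
  note sub = extremalD(1)[OF assms(2)]
  have free: "\<not> clique E Q" if "Q \<subseteq> V" "card Q = t" for Q
    using extremalD(2)[OF assms(2)] that unfolding packs_one by blast
  note Ed = host_subD[OF sub]
  note tr = extremal_nonadj_trans[OF assms(1,2)]
  note tc = transversal_has_clique[OF assms(1,2) _ assms(4)]
  obtain x0 where x0: "x0 \<in> transversals V p {}" using transversals_through[of "{}" V "{}" p] by auto
  from tc[OF _ x0] assms(3) obtain C where C: "C \<subseteq> x0 ` p ` V" "card C = t - 1" "clique E C" by auto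
  have CV: "C \<subseteq> V" using C(1) transversals_mem[OF x0] by auto
  have finC: "finite C" using CV assms(1) finite_subset by blast
  have pC: "inj_on p C" by (rule clique_inj_on[OF sub C(3)])
  have Cadj: "(c, d) \<in> E" if "c \<in> C" "d \<in> C" "c \<noteq> d" for c d using C(3) that by (auto simp: clique_def)
  define bad where "bad v c \<longleftrightarrow> c \<in> C \<and> p c \<noteq> p v \<and> (v, c) \<notin> E" for v c
  define f where "f v = (if \<exists>c. bad v c then SOME c. bad v c else SOME c. c \<in> C \<and> p c = p v)" for v
  have bad_unique: "c = d" if "v \<in> V" "bad v c" "bad v d" for v c d
    using tr[of c v d] that Cadj[of c d] CV Ed pC unfolding bad_def inj_on_def
    by (metis subsetD)
  have home: "\<exists>c\<in>C. p c = p v" if "v \<in> V" "\<not> (\<exists>c. bad v c)" for v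
  proof (rule ccontr)
    assume no: "\<not> ?thesis"
    then have "v \<notin> C" by blast
    then have "card (insert v C) = t" using C(2) finC assms(3) by simp
    moreover have "clique E (insert v C)"
      using no that(2) C(3) Ed by (auto simp: clique_def bad_def)
    ultimately show False using free[of "insert v C"] CV that by blast
  qed
  have f1: "f v = c" if "v \<in> V" "bad v c" for v c
    using that bad_unique unfolding f_def by (metis someI)
  have f2: "f v \<in> C" "p (f v) = p v" "\<And>c. c \<in> C \<Longrightarrow> p c \<noteq> p v \<Longrightarrow> (v, c) \<in> E"
    if "v \<in> V" "\<not> (\<exists>c. bad v c)" for v
    using someI_ex[of "\<lambda>c. c \<in> C \<and> p c = p v"] home[OF that] that(2)
    unfolding f_def bad_def by auto
  have fC: "f v \<in> C" if "v \<in> V" for v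
    using f1[OF that] f2(1)[OF that] by (metis bad_def)
  \<comment> \<open>Here \<open>u\<close> gets its colour \<open>c\<close> by lying in the part of
    \<open>c\<close>, and \<open>v\<close> by not being adjacent to \<open>c\<close>. An edge
    \<open>uv\<close> will produce a \<open>t\<close>-clique.\<close>
  have mixed: "(u, v) \<notin> E" if uv: "u \<in> V" "v \<in> V" and u: "\<not> (\<exists>c. bad u c)" and v: "bad v (f u)" for u v
  proof
    assume E: "(u, v) \<in> E"
    define c where "c = f u"
    have c12: "c \<in> C" "p c = p u" using f2(1,2)[OF uv(1) u] by (simp_all add: c_def)
    have "(u, d) \<in> E" if "d \<in> C" "d \<noteq> c" for d
    proof -
      have "p d \<noteq> p u" using inj_onD[OF pC, of d c] that c12 by auto
      then show ?thesis by (rule f2(3)[OF uv(1) u that(1)])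
    qed
    note c = c12 this
    have vc: "(v, c) \<notin> E" "p c \<noteq> p v" using v by (auto simp: bad_def c_def)
    have v_adj: "(v, d) \<in> E" if "d \<in> C" "d \<noteq> c" "p d \<noteq> p v" for d
      using bad_unique[OF uv(2), of d c] that v unfolding bad_def c_def by metis
    show False
    proof (cases "\<exists>d\<in>C. p d = p v")
      \<comment> \<open>No vertex of \<open>C\<close> shares the part of \<open>v\<close>:
        exchanging \<open>c\<close> for \<open>u\<close> and \<open>v\<close> yields a
        \<open>t\<close>-clique.\<close>
      case False
      then have "u \<notin> C - {c}" "v \<notin> insert u (C - {c})" "u \<noteq> v"
        using c pC Ed[OF E] by (auto simp: inj_on_def)
      then have "card (insert v (insert u (C - {c}))) = t" using finC c C(2) assms(3) by simp
      moreover have "clique E (insert v (insert u (C - {c})))"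
      proof -
        have "(v, w) \<in> E" "(u, w) \<in> E" if "w \<in> C - {c}" for w
          using v_adj[of w] c(3)[of w] that False by auto
        then show ?thesis
          using Ed[OF E] clique_subset[OF C(3), of "C - {c}"] by (simp add: clique_insert_iff[OF sub])
      qed
      ultimately show False using free CV uv by (metis Diff_subset insert_subset subset_trans)
    next
      case True
      then obtain d where d: "d \<in> C" "p d = p v" by blast
      \<comment> \<open>Now \<open>d\<close> shares the part of \<open>v\<close>. A transversal
        through \<open>v\<close> and \<open>B\<close> carries a \<open>(t - 1)\<close>-clique
        \<open>Q\<close>, one vertex larger than \<open>B\<close>, which will supply a further
        vertex \<open>y\<close>.\<close>
      define B where "B = C - {d}"
      have dc: "d \<noteq> c" using d vc by auto
      have "inj_on p (insert v B)" using pC d by (auto simp: B_def inj_on_def)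
      moreover have "insert v B \<subseteq> V - {}" using CV uv by (auto simp: B_def)
      ultimately obtain x where x: "x \<in> transversals V p {}" "\<forall>a\<in>insert v B. x (p a) = a"
        using transversals_through by metis
      from tc[OF _ x(1)] assms(3) obtain Q where Q: "Q \<subseteq> x ` p ` V" "card Q = t - 1" "clique E Q" by auto
      have xm: "x (p w) \<in> V" "p (x (p w)) = p w" if "w \<in> V" for w
        using transversals_mem[OF x(1), of w] that by auto
      have QV: "Q \<subseteq> V" using Q(1) xm by auto
      have xi: "y = z" if "y \<in> x ` p ` V" "z \<in> x ` p ` V" "p y = p z" for y z
        using that xm by auto
      have Bx: "insert v B \<subseteq> x ` p ` V" 
      proof
        fix a assume a: "a \<in> insert v B"
        then have "a \<in> V" using CV uv by (auto simp: B_def)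
        moreover have "a = x (p a)" using x(2) a by auto
        ultimately show "a \<in> x ` p ` V" by (metis imageI)
      qed
      \<comment> \<open>Each vertex of \<open>B\<close> misses at most one vertex of
        \<open>Q\<close> (possibly itself), so by counting some \<open>y\<close> in \<open>Q\<close>
        is adjacent to all of \<open>B\<close>.\<close>
      have one: "y = z" if "b \<in> B" "y \<in> Q" "z \<in> Q" "(b, y) \<notin> E" "(b, z) \<notin> E" for b y z
      proof (rule ccontr)
        assume "y \<noteq> z"
        then have yz: "(y, z) \<in> E" using Q(3) that by (auto simp: clique_def)
        have "b \<in> x ` p ` V" "b \<in> V" using that Bx CV by (auto simp: B_def)
        then have "p b \<noteq> p y" "p b \<noteq> p z"
          using xi[of b y] xi[of b z] that Ed[OF yz] yz Q(1) by auto
        then show False using tr[of y b z] Ed[OF yz] Ed[of y b] yz that \<open>b \<in> V\<close> by metis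
      qed
      define N where "N b = (SOME y. y \<in> Q \<and> (b, y) \<notin> E)" for b
      have "\<not> Q \<subseteq> N ` B"
      proof
        assume "Q \<subseteq> N ` B"
        then have "card Q \<le> card B" using finC by (intro surj_card_le) (auto simp: B_def)
        then show False using Q(2) C(2) d finC assms(3) by (simp add: B_def)
      qed
      then obtain y where y: "y \<in> Q" "y \<notin> N ` B" by blast
      have yB: "(b, y) \<in> E" if "b \<in> B" for b
        using one[OF that] y that someI[of "\<lambda>y. y \<in> Q \<and> (b, y) \<notin> E" y] unfolding N_def by blast
      have yV: "y \<in> V" using y QV by blast
      have cB: "c \<in> B" using c dc by (simp add: B_def)
      have "y \<noteq> v" using yB[OF cB] vc Ed by blast
      then have "p y \<noteq> p v" using xi[of y v] y Q(1) Bx by blast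
      \<comment> \<open>Otherwise transitivity through \<open>v\<close> would make \<open>c\<close>
        and \<open>y\<close> nonadjacent.\<close>
      have vy: "(v, y) \<in> E"
        using tr[of c v y] Ed[OF yB[OF cB]] yB[OF cB] vc Ed[of c v] \<open>p y \<noteq> p v\<close> uv by metis
      have pyC: "p y \<noteq> p b" if "b \<in> C" for b
        using \<open>p y \<noteq> p v\<close> yB[of b] that d Ed by (cases "b = d") (auto simp: B_def)
      have yd: "(y, d) \<notin> E"
      proof
        assume yd: "(y, d) \<in> E"
        have "y \<notin> C" using pyC by blast
        then have "card (insert y C) = t" using C(2) finC assms(3) by simp
        moreover have "clique E (insert y C)"
          unfolding clique_insert_iff[OF sub]
        proof (intro conjI ballI impI C(3))
          fix w assume "w \<in> C"
          then show "(y, w) \<in> E" using yd Ed[OF yB[of w]] by (cases "w = d") (auto simp: B_def)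
        qed
        ultimately show False using free[of "insert y C"] CV yV by blast
      qed
      \<comment> \<open>As \<open>y\<close> and \<open>d\<close> are nonadjacent, a missing edge
        \<open>uy\<close> would make \<open>u\<close> and \<open>d\<close> nonadjacent.\<close>
      have uy: "(u, y) \<in> E"
        using tr[of u y d] c(3)[OF d(1) dc] Ed[OF c(3)[OF d(1) dc]] yd pyC[OF d(1)] pyC[OF c(1)] c(2) yV uv
        by metis
      \<comment> \<open>Exchanging \<open>c\<close> and \<open>d\<close> for \<open>u\<close>,
        \<open>v\<close> and \<open>y\<close> gives the forbidden clique.\<close>
      let ?R = "insert y (insert v (insert u (C - {c, d})))"
      have "u \<notin> C - {c, d}" using c pC by (auto simp: inj_on_def)
      moreover have "v \<notin> insert u (C - {c, d})" using d pC Ed[OF E] by (auto simp: inj_on_def)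
      moreover have "y \<notin> insert v (insert u (C - {c, d}))" using pyC vy uy Ed by blast
      moreover have "card (C - {c, d}) = t - 3" "t \<ge> 3"
        using c d dc C(2) finC card_mono[of C "{c, d}"] by (auto simp: card_Diff_subset)
      ultimately have "card ?R = t" using finC by simp
      moreover have "clique E ?R"
      proof -
        have "p w \<noteq> p v" if "w \<in> C - {c, d}" for w
          using inj_onD[OF pC, of w d] that d by auto
        then have vw: "(v, w) \<in> E" if "w \<in> C - {c, d}" for w using v_adj[of w] that by blast
        have uw: "(u, w) \<in> E" if "w \<in> C - {c, d}" for w using c(3) that by blast
        have yw: "(y, w) \<in> E" if "w \<in> C - {c, d}" for w
          using Ed[OF yB[of w]] that by (auto simp: B_def)
        have "clique E (C - {c, d})" using C(3) by (rule clique_subset) auto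
        then show ?thesis
          using vw uw yw Ed[OF E] Ed[OF vy] Ed[OF uy] by (simp add: clique_insert_iff[OF sub])
      qed
      ultimately show False using free[of ?R] CV uv yV by blast
    qed
  qed
  show ?thesis
  proof (rule colorableI[OF finC C(2) fC])
    fix u v assume uv: "u \<in> V" "v \<in> V" and E: "(u, v) \<in> E"
    show "f u \<noteq> f v"
    proof
      assume eq: "f u = f v"
      consider "bad u (f u)" "bad v (f v)" | "\<not> (\<exists>c. bad u c)" "bad v (f v)"
        | "bad u (f u)" "\<not> (\<exists>c. bad v c)" | "\<not> (\<exists>c. bad u c)" "\<not> (\<exists>c. bad v c)"
        using f1 uv by metis
      then show False
      proof cases
        case 1
        then show False using tr[of u "f u" v] uv eq E CV Ed fC unfolding bad_def by (metis subsetD)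
      next
        case 2
        then show False using mixed[OF uv] eq E by simp
      next
        case 3
        then show False using mixed[OF uv(2,1)] eq E Ed by metis
      next
        case 4
        then show False using f2(2)[OF uv(1)] f2(2)[OF uv(2)] eq Ed[OF E] by metis
      qed
    qed
  qed
qed

subsection \<open>Several disjoint cliques\<close>

text \<open>A vertex of a collapsed extremal graph misses a whole part of size \<open>m\<close>; filling in its star
  creates no two disjoint cliques.\<close>

lemma two_packing_gain:
  assumes "finite V" "extremal V p t 1 E" "t \<ge> 2"
    and "t - 1 \<le> card {i \<in> p ` V. m \<le> card (part V p i)}" "t \<le> card (p ` V)"
  shows "\<exists>E'. host_sub V p E' \<and> \<not> packs t E' 2 V \<and> card E + 2 * m \<le> card E'"
proof -
  obtain J where J: "J \<subseteq> {i \<in> p ` V. m \<le> card (part V p i)}" "card J = t - 1"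
    using assms(4) by (meson obtain_subset_with_card_n)
  have finJ: "finite J" using J(1) assms(1) by (auto intro: finite_subset)
  have "\<not> p ` V \<subseteq> J" using card_mono[OF finJ, of "p ` V"] J(2) assms(3,5) by auto
  \<comment> \<open>\<open>J\<close> supplies \<open>t - 1\<close> parts of size at least
    \<open>m\<close>; one more part, of any size, makes \<open>t\<close> representatives, which
    cannot form a clique.\<close>
  then obtain j where j: "j \<in> p ` V" "j \<notin> J" by blast
  obtain x where x: "x \<in> transversals V p {}" using transversals_through[of "{}" V "{}" p] by auto
  have xm: "x i \<in> V" "p (x i) = i" if "i \<in> p ` V" for i
    using transversals_mem[OF x] that by auto
  define D where "D = pullback V p (\<lambda>v. x (p v)) E"
  have ext: "extremal V p t 1 D" unfolding D_def by (rule extremal_pullback[OF assms(1,2) x])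
  have sub: "host_sub V p D" and subE: "host_sub V p E" using ext assms(2) by (simp_all add: extremal_def)
  define Q where "Q = x ` insert j J"
  have JV: "insert j J \<subseteq> p ` V" using J(1) j(1) by auto
  have "inj_on x (insert j J)" by (rule inj_onI) (metis JV subsetD xm(2))
  then have "card Q = t" using finJ J(2) j(2) assms(3) by (simp add: Q_def card_image del: image_insert)
  moreover have "Q \<subseteq> V" using JV xm by (auto simp: Q_def)
  ultimately have "\<not> clique E Q" using extremalD(2)[OF assms(2)] unfolding packs_one by blast
  then obtain i i' where ii': "i \<in> insert j J" "i' \<in> insert j J" "i \<noteq> i'" "(x i, x i') \<notin> E"
    unfolding clique_def Q_def by blast
  obtain i i' where i: "i \<in> J" "i' \<in> p ` V" "i \<noteq> i'" "(x i', x i) \<notin> E"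
  proof (cases "i \<in> J")
    case True
    then show ?thesis using that[of i i'] ii' JV host_subD[OF subE] by blast
  next
    case False
    then show ?thesis using that[of i' i] ii' JV by blast
  qed
  define v where "v = x i'"
  have v: "v \<in> V" "p v = i'" using xm[OF i(2)] by (simp_all add: v_def)
  let ?P = "part V p i"
  let ?E = "D \<union> star V p v"
  have new: "({v} \<times> ?P \<union> ?P \<times> {v}) \<inter> D = {}"
  proof -
    have "(v, w) \<notin> D" if "w \<in> ?P" for w
      using i(4) that v by (auto simp: D_def pullback_def part_def)
    moreover have "(w, v) \<notin> D" if "w \<in> ?P" for w
      using calculation[OF that] host_subD[OF sub] by blast
    ultimately show ?thesis by blast
  qed
  have finP: "finite ?P" using assms(1) by (simp add: part_def)
  have vP: "v \<notin> ?P" using v i(3) by (simp add: part_def)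
  have s: "host_sub V p ?E" by (intro host_sub_Un sub star_sub)
  have "D \<union> ({v} \<times> ?P \<union> ?P \<times> {v}) \<subseteq> ?E"
    using v i(3) by (auto simp: star_def cross_pairs_def part_def)
  then have "card (D \<union> ({v} \<times> ?P \<union> ?P \<times> {v})) \<le> card ?E"
    by (rule card_mono[OF host_sub_finite[OF assms(1) s]])
  moreover have "card (D \<union> ({v} \<times> ?P \<union> ?P \<times> {v})) = card D + card ({v} \<times> ?P \<union> ?P \<times> {v})"
    using new finP host_sub_finite[OF assms(1) sub] by (intro card_Un_disjoint) auto
  moreover have "card ({v} \<times> ?P \<union> ?P \<times> {v}) = card ({v} \<times> ?P) + card (?P \<times> {v})"
    using finP vP by (intro card_Un_disjoint) auto
  moreover have "card D = card E"
    using extremalD[OF ext] extremalD[OF assms(2)] by (meson le_antisym)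
  moreover have "m \<le> card ?P" using i(1) J(1) by blast
  ultimately have "card E + 2 * m \<le> card ?E" by (simp add: card_cartesian_product)
  moreover have "\<not> packs t ?E 2 V"
  proof -
    have "\<not> packs t D 1 (V - {v})"
      using extremalD(2)[OF ext] packs_mono[of t D 1 "V - {v}" V D] by blast
    from packs_star[OF this] show ?thesis by (simp add: numeral_2_eq_2)
  qed
  ultimately show ?thesis using s by blast
qed

section \<open>Thresholds for part sizes\<close>

lemma largest_common_size:
  assumes "finite V" "t \<ge> 2" "t - 1 \<le> card {i \<in> p ` V. N \<le> card (part V p i)}"
  shows "\<exists>m\<ge>N. t - 1 \<le> card {i \<in> p ` V. m \<le> card (part V p i)} \<and>
            card {i \<in> p ` V. m < card (part V p i)} < t - 1"
proof -
  let ?P = "\<lambda>m. t - 1 \<le> card {i \<in> p ` V. m \<le> card (part V p i)}"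
  have bound: "m \<le> card V" if "?P m" for m
  proof -
    have "card {i \<in> p ` V. m \<le> card (part V p i)} > 0" using that assms(2) by linarith
    then obtain i where "m \<le> card (part V p i)" by (auto simp: card_gt_0_iff)
    also have "\<dots> \<le> card V" using assms(1) by (intro card_mono) (auto simp: part_def)
    finally show ?thesis .
  qed
  \<comment> \<open>This is the size of the \<open>(t - 1)\<close>-st largest part.\<close>
  define m where "m = (GREATEST m. ?P m)"
  have "?P m" unfolding m_def using GreatestI_nat[of ?P N "card V"] assms(3) bound by blast
  moreover have "N \<le> m" unfolding m_def using Greatest_le_nat[of ?P N "card V"] assms(3) bound by blast
  moreover have "\<not> ?P (Suc m)" unfolding m_def
    using Greatest_le_nat[of ?P "Suc (GREATEST m. ?P m)" "card V"] bound by (metis Suc_n_not_le_n)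
  ultimately show ?thesis by (auto simp: Suc_le_eq not_le)
qed

lemma card_small_parts:
  assumes "finite V" "card (p ` V) \<le> r"
  shows "card {v \<in> V. card (part V p (p v)) \<le> m} \<le> r * m"
proof -
  define S where "S = {v \<in> V. card (part V p (p v)) \<le> m}"
  have finS: "finite S" using assms(1) by (simp add: S_def)
  have "S \<subseteq> (\<Union>i\<in>p ` S. part V p i)" by (auto simp: part_def S_def)
  then have "card S \<le> card (\<Union>i\<in>p ` S. part V p i)"
    using assms(1) finS by (intro card_mono) (auto simp: part_def)
  also have "\<dots> \<le> (\<Sum>i\<in>p ` S. card (part V p i))" using finS by (intro card_UN_le) auto
  also have "\<dots> \<le> (\<Sum>i\<in>p ` S. m)" by (rule sum_mono) (auto simp: S_def)
  also have "\<dots> = card (p ` S) * m" by simp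
  also have "\<dots> \<le> r * m"
  proof (rule mult_right_mono)
    have "card (p ` S) \<le> card (p ` V)" using assms(1) by (intro card_mono) (auto simp: S_def)
    then show "card (p ` S) \<le> r" using assms(2) by simp
  qed simp
  finally show ?thesis unfolding S_def .
qed

text \<open>Outside \<open>T\<close> the graph is kept; a vertex of \<open>T\<close> sees only the parts larger than \<open>m\<close>, which are
  too few to complete a clique.\<close>

lemma card_le_extremal_plus:
  assumes "finite V" "extremal V p t 1 E" "t \<ge> 2" "T \<subseteq> V" "host_sub V p F" "\<not> packs t F 1 (V - T)"
    and few: "card {i \<in> p ` V. m < card (part V p i)} < t - 1" and r: "card (p ` V) \<le> r"
  shows "card F \<le> card E + 2 * (card T * (r * m)) + card T * card T"
proof -
  define G where "G = {(u, w) \<in> F. u \<notin> T \<and> w \<notin> T} \<union>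
    {(u, w) \<in> cross_pairs V p. u \<in> T \<and> w \<notin> T \<and> m < card (part V p (p w)) \<or>
        w \<in> T \<and> u \<notin> T \<and> m < card (part V p (p u))}"
  have sub: "host_sub V p G"
    using host_subD[OF assms(5)] by (auto simp: G_def host_sub_def sym_def cross_pairs_def)
  have "\<not> packs t G 1 V"
  proof
    assume "packs t G 1 V"
    then obtain Q where Q: "Q \<subseteq> V" "card Q = t" "clique G Q" unfolding packs_one by blast
    have finQ: "finite Q" using Q(1) assms(1) finite_subset by blast
    show False
    proof (cases "Q \<inter> T = {}")
      case True
      then have "clique F Q" using Q(3) by (auto simp: clique_def G_def disjoint_iff)
      moreover have "Q \<subseteq> V - T" using True Q(1) by blast
      ultimately show False using assms(6) Q(2) unfolding packs_one by blast
    next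
      case False
      then obtain v where v: "v \<in> Q" "v \<in> T" by blast
      have "m < card (part V p (p w))" if "w \<in> Q - {v}" for w
      proof -
        have "(v, w) \<in> G" using Q(3) v that by (auto simp: clique_def)
        then show ?thesis using v by (auto simp: G_def)
      qed
      then have "p ` (Q - {v}) \<subseteq> {i \<in> p ` V. m < card (part V p i)}" using Q(1) by auto
      then have "card (p ` (Q - {v})) < t - 1"
        using card_mono[of "{i \<in> p ` V. m < card (part V p i)}" "p ` (Q - {v})"] few assms(1)
        by simp
      moreover have "inj_on p (Q - {v})"
        using clique_inj_on[OF sub Q(3)] by (rule inj_on_subset) blast
      ultimately show False using v Q(2) finQ by (simp add: card_image)
    qed
  qed
  then have le: "card G \<le> card E" by (rule extremalD(3)[OF assms(2) sub])
  define S where "S = {w \<in> V. card (part V p (p w)) \<le> m}"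
  have finS: "finite S" "finite T" using assms(1) finite_subset[OF assms(4,1)] by (auto simp: S_def)
  have S: "card S \<le> r * m" unfolding S_def by (rule card_small_parts[OF assms(1) r])
  \<comment> \<open>Only pairs inside \<open>T\<close> and pairs joining \<open>T\<close> to a part
    of size at most \<open>m\<close> can be lost.\<close>
  have "F \<subseteq> G \<union> (T \<times> S \<union> S \<times> T) \<union> T \<times> T"
  proof
    fix e assume e: "e \<in> F"
    obtain u w where uw: "e = (u, w)" by (cases e)
    show "e \<in> G \<union> (T \<times> S \<union> S \<times> T) \<union> T \<times> T"
      using e host_subD[OF assms(5), of u w] by (auto simp: uw G_def S_def cross_pairs_def)
  qed
  then have "card F \<le> card (G \<union> (T \<times> S \<union> S \<times> T) \<union> T \<times> T)"
    using finS host_sub_finite[OF assms(1) sub] by (intro card_mono) auto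
  also have "\<dots> \<le> card G + (card T * card S + card S * card T) + card T * card T"
    using card_Un_le[of "G \<union> (T \<times> S \<union> S \<times> T)" "T \<times> T"] card_Un_le[of G "T \<times> S \<union> S \<times> T"]
      card_Un_le[of "T \<times> S" "S \<times> T"] by (simp add: card_cartesian_product)
  also have "\<dots> \<le> card E + (card T * (r * m) + (r * m) * card T) + card T * card T"
    using le S by (intro add_mono mult_mono) auto
  finally show ?thesis by (simp add: mult.commute)
qed

text \<open>Try \<open>b = b0\<close>. If some element of \<open>A\<close> lies between
  \<open>b0\<close> and \<open>f b0\<close>, raise the lower bound to \<open>max b0 (f b0)\<close>:
  that element is below every later threshold, so this happens at most \<open>r\<close> times and
  \<open>B\<close> does not depend on \<open>A\<close>. Applied to part sizes, this separates small
  parts from huge ones.\<close>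

lemma gap_exists:
  fixes f :: "nat \<Rightarrow> nat"
  shows "\<exists>B. \<forall>A. finite A \<and> card A \<le> r \<longrightarrow> (\<exists>b\<le>B. b0 \<le> b \<and> (\<forall>a\<in>A. a < b \<or> f b \<le> a))"
proof (induction r arbitrary: b0)
  case 0
  then show ?case by (intro exI[of _ b0]) auto
next
  case (Suc r)
  obtain B where B: "\<And>A. finite A \<Longrightarrow> card A \<le> r \<Longrightarrow>
      \<exists>b\<le>B. max b0 (f b0) \<le> b \<and> (\<forall>a\<in>A. a < b \<or> f b \<le> a)"
    using Suc.IH[of "max b0 (f b0)"] by blast
  have "\<exists>b\<le>max b0 B. b0 \<le> b \<and> (\<forall>a\<in>A. a < b \<or> f b \<le> a)" if A: "finite A" "card A \<le> Suc r" for A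
  proof (cases "\<forall>a\<in>A. a < b0 \<or> f b0 \<le> a")
    case True
    then show ?thesis by (intro exI[of _ b0]) auto
  next
    case False
    then obtain a where a: "a \<in> A" "a < f b0" by auto
    then have "card (A - {a}) \<le> r" using A by simp
    then obtain b where b: "b \<le> B" "max b0 (f b0) \<le> b" "\<forall>a\<in>A - {a}. a < b \<or> f b \<le> a"
      using B[of "A - {a}"] A by blast
    then show ?thesis using a by (intro exI[of _ b]) auto
  qed
  then show ?case by blast
qed

lemma packs_Suc_imp: "packs t E (Suc k) V \<Longrightarrow> packs t E k V"
  using packs_mono[OF packs_remove[of t E k V undefined]] by blast

lemma packs_le: "packs t E k V \<Longrightarrow> j \<le> k \<Longrightarrow> packs t E j V"
  by (induction k) (auto simp: le_Suc_eq simp del: packs.simps dest: packs_Suc_imp)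

text \<open>Supplies the vertex to be deleted in the induction on the number of cliques. If every
  vertex were avoided by a packing of \<open>k\<close> cliques, the average collapse would have too
  few arcs for an extremal graph.\<close>

lemma vertex_meeting_packings:
  fixes r t k :: nat
  assumes "t \<ge> 2" "k \<ge> 1"
  shows "\<exists>N. \<forall>(V :: 'a set) (p :: 'a \<Rightarrow> 'c) E. finite V \<longrightarrow> card (p ` V) \<le> r \<longrightarrow>
           t - 1 \<le> card {i \<in> p ` V. N \<le> card (part V p i)} \<longrightarrow> extremal V p t (Suc k) E \<longrightarrow>
           (\<exists>v\<in>V. \<not> packs t E k (V - {v}))"
proof -
  \<comment> \<open>\<open>c b\<close> bounds \<open>T\<close>: at most \<open>k * t\<close>
    vertices of a maximal packing and \<open>r * b\<close> vertices in small parts.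
    \<open>w b\<close> bounds the vertices of all packings \<open>W v\<close> together. Large parts
    have size at least \<open>f b\<close>, which makes hitting one of these vertices rare
    enough.\<close>
  define c where "c b = k * t + r * b" for b
  define w where "w b = c b * (k * t)" for b
  define f where "f b = c b + w b * (2 * (c b * r) + 1) + 1" for b
  obtain B where B: "\<And>A. finite A \<and> card A \<le> r \<Longrightarrow> \<exists>b\<le>B. 0 \<le> b \<and> (\<forall>a\<in>A. a < b \<or> f b \<le> a)"
    using gap_exists[of r 0 f] by blast
  have "\<exists>v\<in>V. \<not> packs t E k (V - {v})"
    if fin: "finite V" and r: "card (p ` V) \<le> r"
      and big: "t - 1 \<le> card {i \<in> p ` V. c B * c B + 1 \<le> card (part V p i)}"
      and ext: "extremal V p t (Suc k) E"
    for V :: "'a set" and p :: "'a \<Rightarrow> 'c" and E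
  proof (rule ccontr)
    assume "\<not> ?thesis"
    then have all: "packs t E k (V - {v})" if "v \<in> V" for v using that by blast
    note sub = extremalD(1)[OF ext] and free = extremalD(2)[OF ext]
    have "V \<noteq> {}" using big assms(1) by auto
    then obtain v0 where "v0 \<in> V" by blast
    \<comment> \<open>Some clique exists because \<open>k \<ge> 1\<close>, so there are at least
      \<open>t\<close> parts, as \<open>two_packing_gain\<close> requires.\<close>
    from packs_le[OF all[OF this] assms(2)] obtain Q0 where
      Q0: "Q0 \<subseteq> V - {v0}" "card Q0 = t" "clique E Q0" unfolding packs_one by blast
    have "t = card (p ` Q0)" using Q0 clique_inj_on[OF sub Q0(3)] by (simp add: card_image)
    also have "\<dots> \<le> card (p ` V)" using Q0(1) fin by (intro card_mono) auto
    finally have parts: "t \<le> card (p ` V)" .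
    obtain m where m: "c B * c B + 1 \<le> m" "t - 1 \<le> card {i \<in> p ` V. m \<le> card (part V p i)}"
      "card {i \<in> p ` V. m < card (part V p i)} < t - 1"
      using largest_common_size[OF fin assms(1) big] by blast
    obtain E0 where E0: "extremal V p t 1 E0" using extremal_exists[OF fin assms(1), of 1 p] by auto
    obtain E' where E': "host_sub V p E'" "\<not> packs t E' 2 V" "card E0 + 2 * m \<le> card E'"
      using two_packing_gain[OF fin E0 assms(1) m(2) parts] by blast
    have "\<not> packs t E' (Suc k) V" using E'(2) packs_le[of t E' "Suc k" V 2] assms(2) by auto
    then have gain: "card E0 + 2 * m \<le> card E" using extremalD(3)[OF ext E'(1)] E'(3) by linarith

    obtain T0 where T0: "T0 \<subseteq> V" "finite T0" "card T0 \<le> k * t" "\<not> packs t E 1 (V - T0)"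
      using packing_cover[OF free] assms(1) by auto
    have "card ((\<lambda>i. card (part V p i)) ` p ` V) \<le> r"
      using r card_image_le[of "p ` V" "\<lambda>i. card (part V p i)"] fin by simp
    then obtain b where b: "b \<le> B" "\<forall>v\<in>V. card (part V p (p v)) < b \<or> f b \<le> card (part V p (p v))"
      using B[of "(\<lambda>i. card (part V p i)) ` p ` V"] fin by auto
    define S where "S = {v \<in> V. card (part V p (p v)) \<le> b}"
    define T where "T = T0 \<union> S"
    have finS: "finite S" using fin by (simp add: S_def)
    have "card S \<le> r * b" unfolding S_def by (rule card_small_parts[OF fin r])
    then have T: "T \<subseteq> V" "finite T" "card T \<le> c b"
      using card_Un_le[of T0 S] T0 finS by (auto simp: T_def S_def c_def)
    have freeT: "\<not> packs t E 1 (V - T)"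
      using T0(4) packs_mono[of t E 1 "V - T" "V - T0" E] by (auto simp: T_def simp del: packs.simps)

    \<comment> \<open>Without the edges inside \<open>T\<close>, every clique meets \<open>T\<close>
      in at most one vertex. The deletion costs at most \<open>c B * c B < m\<close> arcs, so half
      of the surplus \<open>2 * m\<close> survives.\<close>
    define E1 where "E1 = E - T \<times> T"
    have E1sub: "host_sub V p E1" using sub by (auto simp: E1_def host_sub_def sym_def)
    have "card E \<le> card (E1 \<union> T \<times> T)"
      using T(2) host_sub_finite[OF fin E1sub] by (intro card_mono) (auto simp: E1_def)
    also have "\<dots> \<le> card E1 + card T * card T"
      using card_Un_le[of E1 "T \<times> T"] by (simp add: card_cartesian_product)
    also have "card T * card T \<le> c b * c b" using T(3) by (intro mult_mono) auto
    also have "c b * c b \<le> c B * c B" using b(1) by (intro mult_mono) (auto simp: c_def)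
    finally have E1: "card E0 + m \<le> card E1" and cm: "c b * c b \<le> m"
      using gain m(1) mult_mono[of "c b" "c B" "c b" "c B"] b(1) by (auto simp: c_def)

    have "\<forall>v\<in>T. \<exists>W\<subseteq>V - {v}. finite W \<and> card W = k * t \<and> packs t E k W"
      using packs_vertices[OF all] T(1) assms(1) by (meson subsetD pos2 less_le_trans)
    then obtain W where W: "\<And>v. v \<in> T \<Longrightarrow> W v \<subseteq> V - {v} \<and> finite (W v) \<and> card (W v) = k * t \<and> packs t E k (W v)"
      by metis
    \<comment> \<open>The vertices that a good transversal has to avoid. Those in \<open>T\<close>
      can be left out: a clique of \<open>E1\<close> has at most one vertex \<open>v\<close> there,
      and \<open>W v\<close> avoids \<open>v\<close>.\<close>
    define U where "U = (\<Union>v\<in>T. W v) - T"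
    have UV: "U \<subseteq> V - T" using W by (fastforce simp: U_def)
    have finU: "finite U" using UV fin finite_subset by blast
    have "card U \<le> card (\<Union>v\<in>T. W v)" using W T(2) by (intro card_mono) (auto simp: U_def)
    also have "\<dots> \<le> (\<Sum>v\<in>T. card (W v))" by (rule card_UN_le[OF T(2)])
    also have "\<dots> \<le> c b * (k * t)" using W T(3) by simp
    finally have cardU: "card U \<le> w b" by (simp add: w_def)

    define X where "X = transversals V p T"
    define F where "F x = pullback V p (collapse p T x) E1" for x
    define bad where "bad = {x \<in> X. \<exists>u\<in>U. x (p u) = u}"
    have finX: "finite X" using fin by (simp add: X_def finite_transversals)
    have Fsub: "host_sub V p (F x)" for x
      using E1sub unfolding F_def host_sub_def[of V p E1] by (intro pullback_host_sub) simp
    have image: "clique E1 (collapse p T x ` Q)" "card (collapse p T x ` Q) = card Q"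
      "collapse p T x ` Q \<subseteq> V" if "x \<in> X" "Q \<subseteq> V" "clique (F x) Q" for x Q
    proof -
      show "clique E1 (collapse p T x ` Q)" "card (collapse p T x ` Q) = card Q"
        using clique_pullback[OF E1sub that(3)[unfolded F_def]] by (auto simp: card_image)
      show "collapse p T x ` Q \<subseteq> V"
        using collapse_facts(1)[OF _ T(1)] that by (auto simp: X_def)
    qed
    have clE: "clique E R" if "clique E1 R" for R using that by (auto simp: clique_def E1_def)
    \<comment> \<open>A crude bound for every transversal: the collapse maps the outside of
      \<open>T\<close> to itself, so no clique arises there, and the excess over
      \<open>card E0\<close> is at most linear in \<open>m\<close>.\<close>
    have any: "card (F x) \<le> card E0 + (2 * (c b * (r * m)) + c b * c b)" if x: "x \<in> X" for x
    proof -
      have "\<not> packs t (F x) 1 (V - T)"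
      proof
        assume "packs t (F x) 1 (V - T)"
        then obtain Q where Q: "Q \<subseteq> V - T" "card Q = t" "clique (F x) Q" unfolding packs_one by blast
        have QV: "Q \<subseteq> V" using Q(1) by blast
        have "collapse p T x ` Q \<subseteq> V - T"
          using collapse_facts(1,3)[OF x[unfolded X_def] T(1)] Q(1) by blast
        then show False using freeT clE image[OF x QV Q(3)] Q(2) unfolding packs_one by metis
      qed
      from card_le_extremal_plus[OF fin E0 assms(1) T(1) Fsub this m(3) r]
      have "card (F x) \<le> card E0 + 2 * (card T * (r * m)) + card T * card T" .
      also have "\<dots> \<le> card E0 + 2 * (c b * (r * m)) + c b * c b"
        using T(3) by (intro add_mono mult_mono) auto
      finally show ?thesis by simp
    qed
    \<comment> \<open>The image \<open>R\<close> of a \<open>t\<close>-clique would have to meet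
      \<open>T\<close>, in one vertex \<open>v\<close>, and otherwise consist of representatives
      outside \<open>U\<close>. So \<open>R\<close> is disjoint from \<open>W v\<close>, and
      together they give \<open>Suc k\<close> disjoint cliques in \<open>E\<close>.\<close>
    have good: "card (F x) \<le> card E0" if x: "x \<in> X" "x \<notin> bad" for x
    proof (rule extremalD(3)[OF E0 Fsub], rule notI)
      assume "packs t (F x) 1 V"
      then obtain Q where Q: "Q \<subseteq> V" "card Q = t" "clique (F x) Q" unfolding packs_one by blast
      define R where "R = collapse p T x ` Q"
      have R: "clique E1 R" "card R = t" "R \<subseteq> V" using image[OF x(1) Q(1,3)] Q(2) by (simp_all add: R_def)
      show False
      proof (cases "R \<inter> T = {}")
        case True
        then have "R \<subseteq> V - T" using R(3) by blast
        then show False using freeT clE[OF R(1)] R(2) unfolding packs_one by blast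
      next
        case False
        then obtain v where v: "v \<in> R" "v \<in> T" by blast
        have "y \<notin> W v" if y: "y \<in> R" for y
        proof (cases "y = v")
          case True
          then show ?thesis using W[OF v(2)] by blast
        next
          case False
          then have "(v, y) \<in> E1" using R(1) v(1) y by (auto simp: clique_def)
          then have yT: "y \<notin> T" using v(2) by (auto simp: E1_def)
          obtain q where q: "q \<in> Q" "y = collapse p T x q" using y by (auto simp: R_def)
          have qV: "q \<in> V" using q(1) Q(1) by blast
          note cf = collapse_facts[OF x(1)[unfolded X_def] T(1) qV]
          have "x (p y) = y" using cf q(2) yT by (auto simp: collapse_def)
          then have "y \<notin> U" using x by (auto simp: bad_def)
          then show ?thesis using v(2) yT by (auto simp: U_def)
        qed
        then have "W v \<subseteq> V - R" using W[OF v(2)] by blast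
        then have "packs t E k (V - R)" using W[OF v(2)] packs_mono by blast
        then have "packs t E (Suc k) V" using R clE[OF R(1)] by auto
        then show False using free by blast
      qed
    qed

    \<comment> \<open>The surplus \<open>m\<close> of \<open>E1\<close> over \<open>E0\<close> must
      come from bad transversals alone. Since \<open>c b * c b \<le> m\<close>, the factor
      \<open>m\<close> cancels and \<open>card X\<close> is bounded by a multiple of
      \<open>card bad\<close>.\<close>
    have "card X * (card E0 + m) \<le> card X * card E1" using E1 by simp
    also have "\<dots> = (\<Sum>x\<in>X. card (F x))"
      using sum_card_pullback[OF fin T(1), of E1 p] E1sub by (simp add: X_def F_def host_sub_def)
    also have "\<dots> \<le> (\<Sum>x\<in>X. card E0 + (if x \<in> bad then 2 * (c b * (r * m)) + c b * c b else 0))"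
      using any good by (intro sum_mono) auto
    also have "\<dots> = card X * card E0 + card bad * (2 * (c b * (r * m)) + c b * c b)"
    proof -
      have "X \<inter> bad = bad" by (auto simp: bad_def)
      then show ?thesis using finX by (simp add: sum.distrib sum.If_cases)
    qed
    also have "\<dots> \<le> card X * card E0 + card bad * (2 * (c b * (r * m)) + m)"
      using cm by (intro add_mono mult_mono) auto
    also have "2 * (c b * (r * m)) + m = (2 * (c b * r) + 1) * m" by (simp add: algebra_simps)
    finally have "card X * m \<le> card bad * (2 * (c b * r) + 1) * m"
      by (simp only: distrib_left[of "card X"] mult.assoc add_le_cancel_left)
    moreover have "0 < m" using m(1) by simp
    ultimately have X_le: "card X \<le> card bad * (2 * (c b * r) + 1)" by (metis mult_le_cancel2)

    \<comment> \<open>Each large part keeps at least \<open>d\<close> vertices outside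
      \<open>T\<close>, so a given vertex of \<open>U\<close> is hit by at most a fraction
      \<open>1/d\<close> of all transversals. The final \<open>+ 1\<close> makes the closing
      inequality strict.\<close>
    define d where "d = w b * (2 * (c b * r) + 1) + 1"
    have "card bad * d \<le> (\<Sum>u\<in>U. card {x \<in> X. x (p u) = u}) * d"
    proof -
      have "bad = (\<Union>u\<in>U. {x \<in> X. x (p u) = u})" by (auto simp: bad_def)
      then show ?thesis using card_UN_le[OF finU] by (intro mult_right_mono) auto
    qed
    also have "\<dots> \<le> (\<Sum>u\<in>U. card X)"
      unfolding sum_distrib_right
    proof (rule sum_mono)
      fix u assume "u \<in> U"
      then have u: "u \<in> V - T" using UV by blast
      then have "f b \<le> card (part V p (p u))" using b(2) by (auto simp: T_def S_def)
      moreover have "part (V - T) p (p u) = part V p (p u) - T" by (auto simp: part_def)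
      ultimately have "d \<le> card (part (V - T) p (p u))"
        using diff_card_le_card_Diff[OF T(2), of "part V p (p u)"] T(3) by (simp add: d_def f_def)
      then have "card {x \<in> X. x (p u) = u} * d \<le> card {x \<in> X. x (p u) = u} * card (part (V - T) p (p u))"
        by (rule mult_left_mono) simp
      also have "\<dots> = card X" unfolding X_def by (rule card_transversals_through[OF u])
      finally show "card {x \<in> X. x (p u) = u} * d \<le> card X" .
    qed
    also have "\<dots> \<le> w b * card X" using cardU by simp
    finally have bad_le: "card bad * d \<le> w b * card X" .
    have "X \<noteq> {}" using transversals_through[of "{}" V T p] by (auto simp: X_def)
    then have posX: "card X > 0" using finX by (simp add: card_gt_0_iff)
    have "card X * d \<le> card bad * (2 * (c b * r) + 1) * d" using X_le by (rule mult_right_mono) simp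
    also have "\<dots> = card bad * d * (2 * (c b * r) + 1)" by (simp add: algebra_simps)
    also have "\<dots> \<le> w b * card X * (2 * (c b * r) + 1)" using bad_le by (rule mult_right_mono) simp
    also have "\<dots> < card X * d" using posX by (simp add: d_def algebra_simps)
    finally show False by simp
  qed
  then show ?thesis by blast
qed

text \<open>Delete the vertex \<open>v\<close> given by \<open>vertex_meeting_packings\<close>. The
  rest is again extremal, for one clique fewer, because the star of \<open>v\<close> can be added to
  any competitor on \<open>V - {v}\<close>.\<close>

lemma extremal_structure:
  fixes r t k :: nat
  assumes "t \<ge> 2"
  shows "\<exists>N. \<forall>(V :: 'a set) (p :: 'a \<Rightarrow> 'c) E. finite V \<longrightarrow> card (p ` V) \<le> r \<longrightarrow>
           t - 1 \<le> card {i \<in> p ` V. N \<le> card (part V p i)} \<longrightarrow> extremal V p t (Suc k) E \<longrightarrow>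
           (\<exists>S\<subseteq>V. card S = k \<and> colorable (t - 1) (V - S) E)"
proof (induction k)
  case 0
  have "colorable (t - 1) V E"
    if "finite V" "t - 1 \<le> card {i \<in> p ` V. 0 \<le> card (part V p i)}" "extremal V p t (Suc 0) E"
    for V :: "'a set" and p :: "'a \<Rightarrow> 'c" and E
    using extremal_one_colorable[of V p t E] that assms by simp
  then show ?case by (intro exI[of _ 0]) fastforce
next
  case (Suc k)
  from Suc.IH obtain N1 where N1: "\<forall>(V :: 'a set) (p :: 'a \<Rightarrow> 'c) E. finite V \<longrightarrow> card (p ` V) \<le> r \<longrightarrow>
      t - 1 \<le> card {i \<in> p ` V. N1 \<le> card (part V p i)} \<longrightarrow> extremal V p t (Suc k) E \<longrightarrow>
      (\<exists>S\<subseteq>V. card S = k \<and> colorable (t - 1) (V - S) E)" ..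
  have "1 \<le> Suc k" by simp
  from vertex_meeting_packings[OF assms this] obtain N2 where N2:
    "\<forall>(V :: 'a set) (p :: 'a \<Rightarrow> 'c) E. finite V \<longrightarrow> card (p ` V) \<le> r \<longrightarrow>
      t - 1 \<le> card {i \<in> p ` V. N2 \<le> card (part V p i)} \<longrightarrow> extremal V p t (Suc (Suc k)) E \<longrightarrow>
      (\<exists>v\<in>V. \<not> packs t E (Suc k) (V - {v}))" ..
  \<comment> \<open>Deleting one vertex must leave every large part nonempty and with at least
    \<open>N1\<close> vertices.\<close>
  define N where "N = N1 + N2 + 2"
  have "\<exists>S\<subseteq>V. card S = Suc k \<and> colorable (t - 1) (V - S) E"
    if fin: "finite V" and r: "card (p ` V) \<le> r"
      and big: "t - 1 \<le> card {i \<in> p ` V. N \<le> card (part V p i)}"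
      and ext: "extremal V p t (Suc (Suc k)) E"
    for V :: "'a set" and p :: "'a \<Rightarrow> 'c" and E
  proof -
    note sub = extremalD(1)[OF ext]
    have "card {i \<in> p ` V. N \<le> card (part V p i)} \<le> card {i \<in> p ` V. N2 \<le> card (part V p i)}"
      using fin by (intro card_mono) (auto simp: N_def)
    then have "t - 1 \<le> card {i \<in> p ` V. N2 \<le> card (part V p i)}" using big by linarith
    then obtain v where v: "v \<in> V" "\<not> packs t E (Suc k) (V - {v})" using N2[rule_format, OF fin r _ ext] by blast
    define E' where "E' = E \<inter> (V - {v}) \<times> (V - {v})"
    have E'sub: "host_sub (V - {v}) p E'"
      using sub by (auto simp: E'_def host_sub_def cross_pairs_def sym_def)
    have "extremal (V - {v}) p t (Suc k) E'"
      unfolding extremal_def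
    proof (intro conjI allI impI E'sub)
      show "\<not> packs t E' (Suc k) (V - {v})"
        using v(2) packs_mono[of t E' "Suc k" "V - {v}" "V - {v}" E] by (auto simp: E'_def simp del: packs.simps)
      fix F assume F: "host_sub (V - {v}) p F \<and> \<not> packs t F (Suc k) (V - {v})"
      have finF: "finite F" "finite E'" using host_sub_finite[OF _ conjunct1[OF F]] host_sub_finite[OF _ E'sub] fin by auto
      have finst: "finite (star V p v)" by (rule host_sub_finite[OF fin star_sub])
      have Fsub: "host_sub V p F" using F by (auto simp: host_sub_def cross_pairs_def)
      have "\<not> packs t (F \<union> star V p v) (Suc (Suc k)) V" by (rule packs_star) (use F in blast)
      then have "card (F \<union> star V p v) \<le> card E"
        using extremalD(3)[OF ext host_sub_Un[OF Fsub star_sub]] by blast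
      moreover have "card (F \<union> star V p v) = card F + card (star V p v)"
        using F finF finst by (intro card_Un_disjoint) (auto simp: host_sub_def cross_pairs_def star_def)
      moreover have "E \<subseteq> E' \<union> star V p v"
        using sub by (auto simp: E'_def host_sub_def cross_pairs_def star_def)
      then have "card E \<le> card E' + card (star V p v)"
        using finF finst by (meson card_Un_le card_mono finite_UnI le_trans)
      ultimately show "card F \<le> card E'" by linarith
    qed
    moreover have "card (p ` (V - {v})) \<le> r"
      using card_mono[of "p ` V" "p ` (V - {v})"] fin r by fastforce
    moreover have "t - 1 \<le> card {i \<in> p ` (V - {v}). N1 \<le> card (part (V - {v}) p i)}"
    proof -
      have "i \<in> p ` (V - {v}) \<and> N1 \<le> card (part (V - {v}) p i)" if "N \<le> card (part V p i)" for i
      proof -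
        have "part (V - {v}) p i = part V p i - {v}" by (auto simp: part_def)
        then have "N1 + 1 \<le> card (part (V - {v}) p i)"
          using that diff_card_le_card_Diff[of "{v}" "part V p i"] by (simp add: N_def)
        moreover from this have "part (V - {v}) p i \<noteq> {}" by auto
        ultimately show ?thesis by (auto simp: part_def)
      qed
      then have "{i \<in> p ` V. N \<le> card (part V p i)}
          \<subseteq> {i \<in> p ` (V - {v}). N1 \<le> card (part (V - {v}) p i)}" by blast
      from card_mono[OF _ this] fin big show ?thesis by simp
    qed
    ultimately obtain S where S: "S \<subseteq> V - {v}" "card S = k" "colorable (t - 1) (V - {v} - S) E'"
      using N1[rule_format, of "V - {v}" p E'] fin by blast
    have "finite S" using S(1) fin finite_subset by blast
    then have "card (insert v S) = Suc k" using S(1,2) by (subst card_insert_disjoint) auto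
    moreover have "colorable (t - 1) (V - insert v S) E"
    proof -
      have "V - {v} - S = V - insert v S" by blast
      then show ?thesis using S(3) unfolding colorable_def E'_def by auto
    qed
    ultimately show ?thesis using S(1) v(1) by (intro exI[of _ "insert v S"]) auto
  qed
  then show ?case by blast
qed

subsection \<open>Spanning subgraphs of complete multipartite graphs\<close>

lemma packs_of_embedding:
  assumes "inj_on f ({..<k} \<times> {..<t})" "f ` ({..<k} \<times> {..<t}) \<subseteq> V"
    and "\<And>i a b. i < k \<Longrightarrow> a < t \<Longrightarrow> b < t \<Longrightarrow> a \<noteq> b \<Longrightarrow> (f (i, a), f (i, b)) \<in> E"
  shows "packs t E k V"
  using assms
proof (induction k arbitrary: V)
  case (Suc k)
  let ?Q = "f ` ({k} \<times> {..<t})"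
  have inj: "inj_on f ({k} \<times> {..<t})" "inj_on f ({..<k} \<times> {..<t})"
    using Suc.prems(1) by (auto elim: inj_on_subset)
  have "packs t E k (V - ?Q)"
  proof (rule Suc.IH)
    show "f ` ({..<k} \<times> {..<t}) \<subseteq> V - ?Q"
    proof
      fix y assume "y \<in> f ` ({..<k} \<times> {..<t})"
      then obtain i a where y: "y = f (i, a)" "i < k" "a < t" by auto
      have "f (i, a) \<noteq> f (k, b)" if "b < t" for b
        using inj_onD[OF Suc.prems(1), of "(i, a)" "(k, b)"] y(2,3) that by auto
      moreover have "f (i, a) \<in> V" using Suc.prems(2) y(2,3) by auto
      ultimately show "y \<in> V - ?Q" using y(1) by auto
    qed
  qed (use inj Suc.prems(3) in auto)
  moreover have "card ?Q = t" using inj(1) by (simp add: card_image card_cartesian_product)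
  moreover have "clique E ?Q" using Suc.prems(3)[of k] by (auto simp: clique_def)
  moreover have "?Q \<subseteq> V" using Suc.prems(2) by auto
  ultimately show ?case by auto
qed simp

lemma embedding_of_packs:
  assumes "packs t E k V" "t > 0"
  shows "\<exists>f. inj_on f ({..<k} \<times> {..<t}) \<and> f ` ({..<k} \<times> {..<t}) \<subseteq> V \<and>
    (\<forall>i<k. \<forall>a<t. \<forall>b<t. a \<noteq> b \<longrightarrow> (f (i, a), f (i, b)) \<in> E)"
  using assms(1)
proof (induction k arbitrary: V)
  case (Suc k)
  then obtain Q where Q: "Q \<subseteq> V" "card Q = t" "clique E Q" "packs t E k (V - Q)" by auto
  from Suc.IH[OF Q(4)] obtain f where f: "inj_on f ({..<k} \<times> {..<t})"
    "f ` ({..<k} \<times> {..<t}) \<subseteq> V - Q"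
    "\<forall>i<k. \<forall>a<t. \<forall>b<t. a \<noteq> b \<longrightarrow> (f (i, a), f (i, b)) \<in> E" by blast
  have "finite Q" using Q(2) assms(2) by (metis card.infinite less_irrefl)
  then obtain g where g: "bij_betw g {..<t} Q"
    using ex_bij_betw_nat_finite[of Q] Q(2) by (auto simp: atLeast0LessThan)
  then have gi: "inj_on g {..<t}" "\<And>a. a < t \<Longrightarrow> g a \<in> Q" by (auto simp: bij_betw_def)
  define h where "h = (\<lambda>(i, a). if i = k then g a else f (i, a))"
  have fm: "f (i, a) \<in> V - Q" if "i < k" "a < t" for i a using f(2) that by auto
  have "inj_on h ({..<Suc k} \<times> {..<t})"
  proof (rule inj_onI)
    fix x y assume *: "x \<in> {..<Suc k} \<times> {..<t}" "y \<in> {..<Suc k} \<times> {..<t}" "h x = h y"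
    obtain i a j b where xy: "x = (i, a)" "y = (j, b)" by (cases x, cases y)
    show "x = y"
      using * fm[of i a] fm[of j b] gi(2)[of a] gi(2)[of b] inj_onD[OF gi(1), of a b]
        inj_onD[OF f(1), of "(i, a)" "(j, b)"]
      by (auto simp: xy h_def less_Suc_eq split: if_splits)
  qed
  moreover have "h ` ({..<Suc k} \<times> {..<t}) \<subseteq> V"
    using fm subsetD[OF Q(1) gi(2)] by (auto simp: h_def less_Suc_eq)
  moreover have "(g a, g b) \<in> E" if "a < t" "b < t" "a \<noteq> b" for a b
    using Q(3) gi(2)[of a] gi(2)[of b] inj_onD[OF gi(1), of a b] that by (auto simp: clique_def)
  then have "\<forall>i<Suc k. \<forall>a<t. \<forall>b<t. a \<noteq> b \<longrightarrow> (h (i, a), h (i, b)) \<in> E"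
    using f(3) by (auto simp: h_def less_Suc_eq)
  ultimately show ?case by blast
qed auto

section \<open>Passing between edge sets and symmetric relations\<close>

definition arcs :: "'a graph \<Rightarrow> ('a \<times> 'a) set" where
  "arcs F = {(u, v). {u, v} \<in> edges F}"

lemma contains_copies_iff_packs:
  assumes "t > 0"
  shows "contains_copy F (disjoint_copies k (complete_graph t)) \<longleftrightarrow> packs t (arcs F) k (verts F)"
proof -
  have "(\<forall>e\<in>edges (disjoint_copies k (complete_graph t)). f ` e \<in> edges F) \<longleftrightarrow>
      (\<forall>i<k. \<forall>a<t. \<forall>b<t. a \<noteq> b \<longrightarrow> (f (i, a), f (i, b)) \<in> arcs F)" for f :: "nat \<times> nat \<Rightarrow> 'a"
  proof -
    have "(\<forall>e\<in>edges (disjoint_copies k (complete_graph t)). f ` e \<in> edges F) \<longleftrightarrow>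
        (\<forall>i a b. i < k \<and> a < t \<and> b < t \<and> a \<noteq> b \<longrightarrow> f ` Pair i ` {a, b} \<in> edges F)"
      unfolding disjoint_copies_def complete_graph_def graph.sel by blast
    then show ?thesis by (auto simp: arcs_def)
  qed
  moreover have "verts (disjoint_copies k (complete_graph t)) = {..<k} \<times> {..<t}"
    by (simp add: disjoint_copies_def complete_graph_def)
  ultimately have "contains_copy F (disjoint_copies k (complete_graph t)) \<longleftrightarrow>
    (\<exists>f. inj_on f ({..<k} \<times> {..<t}) \<and> f ` ({..<k} \<times> {..<t}) \<subseteq> verts F \<and>
      (\<forall>i<k. \<forall>a<t. \<forall>b<t. a \<noteq> b \<longrightarrow> (f (i, a), f (i, b)) \<in> arcs F))"
    by (simp add: contains_copy_def)
  also have "\<dots> \<longleftrightarrow> packs t (arcs F) k (verts F)"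
    using packs_of_embedding[of _ k t "verts F" "arcs F"] embedding_of_packs[OF _ assms] by metis
  finally show ?thesis .
qed

lemma card_arcs:
  assumes "finite (edges F)" "\<And>e. e \<in> edges F \<Longrightarrow> \<exists>u v. e = {u, v} \<and> u \<noteq> v"
  shows "card (arcs F) = 2 * card (edges F)"
proof -
  let ?A = "\<lambda>e. {(u, v). {u, v} = e}"
  have A: "finite (?A e) \<and> card (?A e) = 2" if e: "e \<in> edges F" for e
  proof -
    obtain u v where uv: "e = {u, v}" "u \<noteq> v" using assms(2)[OF e] by blast
    then have "?A e = {(u, v), (v, u)}" by (auto simp: doubleton_eq_iff)
    then show ?thesis using uv(2) by simp
  qed
  have "arcs F = (\<Union>e\<in>edges F. ?A e)" by (auto simp: arcs_def)
  also have "card \<dots> = (\<Sum>e\<in>edges F. card (?A e))"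
    using assms(1) A by (intro card_UN_disjoint) auto
  finally show ?thesis using A by simp
qed

lemma packs_remove_set:
  assumes "finite S" "packs t E (card S + j) V"
  shows "packs t E j (V - S)"
  using assms
proof (induction S arbitrary: V)
  case (insert v S)
  then have "packs t E (card S + j) (V - {v})" by (intro packs_remove) simp
  then have "packs t E j (V - {v} - S)" by (rule insert.IH)
  moreover have "V - {v} - S = V - insert v S" by blast
  ultimately show ?case by simp
qed simp

section \<open>The complete multipartite host graph\<close>

context
  fixes r :: nat and n :: "nat \<Rightarrow> nat"
begin

abbreviation (input) "host \<equiv> complete_multipartite r n"
abbreviation (input) "host_verts \<equiv> SIGMA i:{1..r}. {..<n i}"
lemma verts_host: "verts host = host_verts"
  by (simp add: complete_multipartite_def Let_def)

lemma edges_host: "edges host = {{u, v} | u v. (u, v) \<in> cross_pairs host_verts fst}"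
  by (simp add: complete_multipartite_def Let_def cross_pairs_def)

lemma finite_host: "finite host_verts" "finite (edges host)"
proof -
  show "finite host_verts" by simp
  then have "finite ((\<lambda>(u, v). {u, v}) ` cross_pairs host_verts fst)"
    by (intro finite_imageI finite_cross_pairs)
  then show "finite (edges host)" by (rule rev_finite_subset) (auto simp: edges_host)
qed

lemma spanning_facts:
  assumes "spanning_subgraph F host"
  shows "verts F = host_verts" "finite (edges F)" "host_sub host_verts fst (arcs F)" "card (arcs F) = 2 * card (edges F)"
proof -
  have sub: "edges F \<subseteq> edges host" "verts F = host_verts"
    using assms by (auto simp: spanning_subgraph_def verts_host)
  show "verts F = host_verts" by (rule sub)
  show fin: "finite (edges F)" using sub(1) finite_host(2) by (rule finite_subset)
  show "host_sub host_verts fst (arcs F)"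
    unfolding host_sub_def
  proof
    show "arcs F \<subseteq> cross_pairs host_verts fst"
    proof (rule subrelI)
      fix u v assume "(u, v) \<in> arcs F"
      then have "{u, v} \<in> edges host" using sub(1) by (auto simp: arcs_def)
      then obtain a b where "{u, v} = {a, b}" "(a, b) \<in> cross_pairs host_verts fst" by (auto simp: edges_host)
      then show "(u, v) \<in> cross_pairs host_verts fst" by (auto simp: cross_pairs_def doubleton_eq_iff)
    qed
    show "sym (arcs F)" by (auto simp: arcs_def sym_def insert_commute)
  qed
  show "card (arcs F) = 2 * card (edges F)"
    using fin
  proof (rule card_arcs)
    fix e assume "e \<in> edges F"
    then have "e \<in> edges host" using sub(1) by blast
    then show "\<exists>u v. e = {u, v} \<and> u \<noteq> v" unfolding edges_host cross_pairs_def by blast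
  qed
qed

lemma spanning_of_host_sub:
  assumes "host_sub host_verts fst E"
  obtains F where "spanning_subgraph F host" "arcs F = E"
proof
  let ?F = "Graph host_verts {{u, v} | u v. (u, v) \<in> E}"
  have "{{u, v} | u v. (u, v) \<in> E} \<subseteq> edges host"
    using assms unfolding edges_host host_sub_def by blast
  then show "spanning_subgraph ?F host" by (simp add: spanning_subgraph_def verts_host)
  show "arcs ?F = E"
    using assms by (auto simp: arcs_def host_sub_def doubleton_eq_iff dest: symD)
qed

lemma finite_edge_counts: "finite {card (edges F) | F. spanning_subgraph F host \<and> P F}"
proof -
  have "card (edges F) \<le> card (edges host)" if "spanning_subgraph F host" for F
    using that by (intro card_mono finite_host) (auto simp: spanning_subgraph_def)
  then have "{card (edges F) | F. spanning_subgraph F host \<and> P F} \<subseteq> {..card (edges host)}" by auto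
  then show ?thesis by (rule finite_subset[OF _ finite_atMost])
qed

section \<open>The extremal number and the extended partite graphs\<close>

context
  fixes t k :: nat
  assumes t: "t \<ge> 2" and k: "k \<ge> 1"
begin

abbreviation (input) "copies \<equiv> disjoint_copies k (complete_graph t)"

lemma free_iff:
  assumes "spanning_subgraph F host"
  shows "free_of F copies \<longleftrightarrow> \<not> packs t (arcs F) k host_verts"
  using contains_copies_iff_packs[of t F k] t spanning_facts(1)[OF assms] by simp

lemma card_edges_le_ex_num:
  assumes "spanning_subgraph F host" "free_of F copies"
  shows "card (edges F) \<le> ex_num host copies"
  unfolding ex_num_def by (rule Max_ge[OF finite_edge_counts]) (use assms in blast)

text \<open>The set under \<open>Max\<close> is nonempty, because an extremal relation exists and
  comes from a spanning subgraph.\<close>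

lemma ex_num_attained:
  "\<exists>F. spanning_subgraph F host \<and> free_of F copies \<and> card (edges F) = ex_num host copies"
proof -
  obtain E where E: "extremal host_verts fst t k E" using extremal_exists[OF finite_host(1) t, of k fst] k by auto
  then obtain F where "spanning_subgraph F host" "arcs F = E"
    using spanning_of_host_sub extremalD(1) by blast
  then have "{card (edges F) | F. spanning_subgraph F host \<and> free_of F copies} \<noteq> {}"
    using free_iff extremalD(2)[OF E] by blast
  from Max_in[OF finite_edge_counts this] show ?thesis unfolding ex_num_def by auto
qed

lemma extremal_arcs:
  assumes "spanning_subgraph F host" "free_of F copies" "card (edges F) = ex_num host copies"
  shows "extremal host_verts fst t k (arcs F)"
  unfolding extremal_def
proof (intro conjI allI impI)
  note sf = spanning_facts[OF assms(1)]
  show "host_sub host_verts fst (arcs F)" by (rule sf(3))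
  show "\<not> packs t (arcs F) k host_verts" using assms(1,2) free_iff by blast
  fix E' assume E': "host_sub host_verts fst E' \<and> \<not> packs t E' k host_verts"
  then obtain F' where F': "spanning_subgraph F' host" "arcs F' = E'"
    using spanning_of_host_sub by blast
  then have "card (edges F') \<le> card (edges F)"
    using card_edges_le_ex_num free_iff E' assms(3) by metis
  then show "card E' \<le> card (arcs F)" using spanning_facts(4)[OF F'(1)] F'(2) sf(4) by simp
qed

text \<open>Of \<open>k\<close> disjoint cliques, the \<open>k - 1\<close> vertices of
  \<open>S\<close> miss at least one. That clique lies in \<open>H\<close>, where two of its
  \<open>t\<close> vertices would share one of \<open>t - 1\<close> independent classes.\<close>

lemma add_incident_edges_free:
  assumes "spanning_subgraph H host" "partite (t - 1) H" "S \<subseteq> verts host" "card S = k - 1"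
  shows "spanning_subgraph (add_incident_edges host H S) host" "free_of (add_incident_edges host H S) copies"
proof -
  let ?F = "add_incident_edges host H S"
  show sp: "spanning_subgraph ?F host"
    using assms(1) by (auto simp: spanning_subgraph_def add_incident_edges_def)
  have S: "S \<subseteq> host_verts" "finite S" using assms(3) finite_host(1) by (auto simp: verts_host intro: finite_subset)
  show "free_of ?F copies"
    unfolding free_iff[OF sp]
  proof
    assume "packs t (arcs ?F) k host_verts"
    then have "packs t (arcs ?F) 1 (host_verts - S)"
      using packs_remove_set[OF S(2), of t "arcs ?F" 1 host_verts] assms(4) k by simp
    then obtain Q where Q: "Q \<subseteq> host_verts - S" "card Q = t" "clique (arcs ?F) Q" unfolding packs_one by blast
    obtain P where P: "(\<Union>i<t - 1. P i) = verts H" "\<forall>i<t - 1. independent_set H (P i)"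
      using assms(2) by (auto simp: partite_def)
    have "\<forall>v\<in>Q. \<exists>i<t - 1. v \<in> P i"
      using Q(1) P(1) spanning_facts(1)[OF assms(1)] by blast
    then obtain q where q: "\<And>v. v \<in> Q \<Longrightarrow> q v < t - 1 \<and> v \<in> P (q v)" by metis
    have "card (q ` Q) \<le> card {..<t - 1}" using q by (intro card_mono) auto
    then have "\<not> inj_on q Q" using Q(2) t by (auto dest: card_image)
    then obtain u v where uv: "u \<in> Q" "v \<in> Q" "u \<noteq> v" "q u = q v" by (auto simp: inj_on_def)
    then have "{u, v} \<in> edges ?F" using Q(3) by (auto simp: clique_def arcs_def)
    moreover have "{u, v} \<inter> S = {}" using Q(1) uv by blast
    ultimately have "{u, v} \<in> edges H" by (auto simp: add_incident_edges_def)
    moreover have "independent_set H (P (q u))" "u \<in> P (q u)" "v \<in> P (q u)"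
      using P(2) q uv by metis+
    ultimately show False by (auto simp: independent_set_def)
  qed
qed

text \<open>\<open>H\<close> is \<open>F\<close> without the edges that meet \<open>S\<close>.
  Filling in all edges at \<open>S\<close> gives a graph that contains \<open>F\<close> and is still
  free of the copies, so maximality of \<open>F\<close> forces equality.\<close>

lemma add_incident_edges_of_colorable:
  assumes F: "spanning_subgraph F host" "free_of F copies" "card (edges F) = ex_num host copies"
    and S: "S \<subseteq> host_verts" "card S = k - 1" "colorable (t - 1) (host_verts - S) (arcs F)"
  shows "\<exists>H. spanning_subgraph H host \<and> partite (t - 1) H \<and> F = add_incident_edges host H S"
proof (intro exI conjI)
  let ?H = "Graph host_verts {e \<in> edges F. e \<inter> S = {}}"
  note sf = spanning_facts[OF F(1)]
  have EF: "edges F \<subseteq> edges host" using F(1) by (simp add: spanning_subgraph_def)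
  show sH: "spanning_subgraph ?H host" 
    using EF unfolding spanning_subgraph_def verts_host graph.sel by blast
  obtain q where q: "\<forall>u\<in>host_verts - S. q u < t - 1 \<and> (\<forall>v\<in>host_verts - S. (u, v) \<in> arcs F \<longrightarrow> q u \<noteq> q v)"
    using S(3) unfolding colorable_def by blast
  \<comment> \<open>Vertices of \<open>S\<close> are isolated in \<open>H\<close> and may take any
    colour; \<open>0\<close> is available since \<open>t \<ge> 2\<close>.\<close>
  define q' where "q' u = (if u \<in> S then 0 else q u)" for u
  define P where "P i = {u \<in> host_verts. q' u = i}" for i
  show pH: "partite (t - 1) ?H"
    unfolding partite_def
  proof (intro exI[of _ P] conjI allI impI)
    have "q' u < t - 1" if "u \<in> host_verts" for u using bspec[OF q, of u] that t by (simp add: q'_def)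
    then show "(\<Union>i<t - 1. P i) = verts ?H" unfolding P_def graph.sel by blast
    show "disjoint_family_on P {..<t - 1}" unfolding disjoint_family_on_def P_def by blast
    fix i
    show "independent_set ?H (P i)"
      unfolding independent_set_def
    proof (intro conjI ballI notI)
      show "P i \<subseteq> verts ?H" unfolding P_def graph.sel by blast
      fix u v assume uv: "u \<in> P i" "v \<in> P i" "{u, v} \<in> edges ?H"
      then have "u \<in> host_verts - S" "v \<in> host_verts - S" "(u, v) \<in> arcs F" by (auto simp: P_def arcs_def)
      moreover from this have "q u = q v" using uv by (simp add: P_def q'_def)
      ultimately show False using q by blast
    qed
  qed
  let ?F = "add_incident_edges host ?H S"
  have sub: "edges F \<subseteq> edges ?F" using EF by (auto simp: add_incident_edges_def)
  note F' = add_incident_edges_free[OF sH pH, of S, unfolded verts_host, OF S(1,2)]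
  have "card (edges ?F) \<le> card (edges F)" using card_edges_le_ex_num[OF F'] F(3) by simp
  then have "edges F = edges ?F"
    using card_seteq[OF spanning_facts(2)[OF F'(1)] sub] by simp
  moreover have "verts F = verts ?F" using sf(1) by (simp add: add_incident_edges_def)
  ultimately show "F = ?F" by (blast intro: graph.expand)
qed

text \<open>Members of the family are free of the copies, which bounds \<open>g_num\<close> from
  above; conversely, an extremal graph exists and by assumption belongs to the family.\<close>

lemma ex_num_eq_g_num:
  assumes "\<And>F. spanning_subgraph F host \<Longrightarrow> free_of F copies \<Longrightarrow> card (edges F) = ex_num host copies \<Longrightarrow>
      \<exists>H S. spanning_subgraph H host \<and> partite (t - 1) H \<and> S \<subseteq> verts host \<and> card S = k - 1 \<and>
        F = add_incident_edges host H S"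
  shows "ex_num host copies = g_num r n k t"
proof -
  have mem: "F \<in> partite_spanning_ext host k t \<longleftrightarrow> (\<exists>H S. spanning_subgraph H host \<and> partite (t - 1) H \<and>
      S \<subseteq> verts host \<and> card S = k - 1 \<and> F = add_incident_edges host H S)" for F
    by (auto simp: partite_spanning_ext_def partite_spanning_def)
  have ext: "spanning_subgraph F host \<and> free_of F copies" if "F \<in> partite_spanning_ext host k t" for F
    using that add_incident_edges_free unfolding mem by blast
  have "finite {card (edges F) | F. F \<in> partite_spanning_ext host k t}"
    by (rule finite_subset[OF _ finite_edge_counts[of "\<lambda>_. True"]]) (use ext in blast)
  moreover obtain F where F: "spanning_subgraph F host" "free_of F copies" "card (edges F) = ex_num host copies"
    using ex_num_attained by blast
  have "F \<in> partite_spanning_ext host k t" unfolding mem by (rule assms[OF F])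
  then have "ex_num host copies \<in> {card (edges F) | F. F \<in> partite_spanning_ext host k t}"
    using F(3) by force
  moreover have "card (edges F) \<le> ex_num host copies" if "F \<in> partite_spanning_ext host k t" for F
    using ext[OF that] card_edges_le_ex_num by blast
  ultimately have "Max {card (edges F) | F. F \<in> partite_spanning_ext host k t} = ex_num host copies"
    by (intro Max_eqI) auto
  then show ?thesis by (simp add: g_num_def)
qed

end

end

theorem theorem1p9:
  fixes r t k :: nat
  assumes "r \<ge> t" and "t \<ge> 3" and "k \<ge> 2"
  shows "\<exists>N::nat. \<forall>n::nat \<Rightarrow> nat.
    (\<forall>i\<in>{1..r}. \<forall>j\<in>{1..r}. i \<le> j \<longrightarrow> n i \<ge> n j) \<and> n (t - 1) \<ge> N \<longrightarrow>
      ex_num (complete_multipartite r n) (disjoint_copies k (complete_graph t)) = g_num r n k t \<and>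
      (\<forall>F. spanning_subgraph F (complete_multipartite r n) \<and>
           free_of F (disjoint_copies k (complete_graph t)) \<and>
           card (edges F) =
             ex_num (complete_multipartite r n) (disjoint_copies k (complete_graph t)) \<longrightarrow>
           (\<exists>H S. spanning_subgraph H (complete_multipartite r n) \<and> partite (t - 1) H \<and>
              S \<subseteq> verts (complete_multipartite r n) \<and> card S = k - 1 \<and>
              F = add_incident_edges (complete_multipartite r n) H S))"
  (is "\<exists>N. \<forall>n. ?large n N \<longrightarrow> ?ex n = _ \<and> (\<forall>F. ?extr n F \<longrightarrow> (\<exists>H S. ?form n F H S))")
proof -
  have t: "t \<ge> 2" and k: "k \<ge> 1" using assms by auto
  from extremal_structure[OF t, of r "k - 1"] obtain N where N:
    "\<forall>(V :: (nat \<times> nat) set) (p :: nat \<times> nat \<Rightarrow> nat) E. finite V \<longrightarrow> card (p ` V) \<le> r \<longrightarrow>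
           t - 1 \<le> card {i \<in> p ` V. N \<le> card (part V p i)} \<longrightarrow> extremal V p t (Suc (k - 1)) E \<longrightarrow>
           (\<exists>S\<subseteq>V. card S = k - 1 \<and> colorable (t - 1) (V - S) E)" ..
  show ?thesis
  \<comment> \<open>\<open>Suc N\<close> instead of \<open>N\<close> makes the first
    \<open>t - 1\<close> parts nonempty, so that their indices really occur as values of
    \<open>fst\<close> on the vertex set.\<close>
  proof (intro exI[of _ "Suc N"] allI impI)
    fix n :: "nat \<Rightarrow> nat"
    assume n: "(\<forall>i\<in>{1..r}. \<forall>j\<in>{1..r}. i \<le> j \<longrightarrow> n i \<ge> n j) \<and> n (t - 1) \<ge> Suc N"
    let ?V = "SIGMA i:{1..r}. {..<n i}"
    have size: "Suc N \<le> n i" if "i \<in> {1..t - 1}" for i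
    proof -
      have "n (t - 1) \<le> n i" using n that assms by auto
      then show ?thesis using n by simp
    qed
    have part_eq: "part ?V fst i = {i} \<times> {..<n i}" if "i \<in> {1..r}" for i
      using that by (auto simp: part_def)
    have finV: "finite ?V" by simp
    have "card (fst ` ?V) \<le> card {1..r}" by (rule card_mono) auto
    then have r: "card (fst ` ?V) \<le> r" by simp
    have "{1..t - 1} \<subseteq> {i \<in> fst ` ?V. N \<le> card (part ?V fst i)}"
    proof
      fix i assume i: "i \<in> {1..t - 1}"
      then have ir: "i \<in> {1..r}" using assms by auto
      then have "(i, 0) \<in> ?V" using size[OF i] by simp
      then have "i \<in> fst ` ?V" by force
      moreover have "N \<le> card (part ?V fst i)"
        using size[OF i] unfolding part_eq[OF ir] by (simp add: card_cartesian_product)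
      ultimately show "i \<in> {i \<in> fst ` ?V. N \<le> card (part ?V fst i)}" by blast
    qed
    then have "card {1..t - 1} \<le> card {i \<in> fst ` ?V. N \<le> card (part ?V fst i)}"
      by (intro card_mono) auto
    then have big: "t - 1 \<le> card {i \<in> fst ` ?V. N \<le> card (part ?V fst i)}" by simp
    have found: "\<exists>H S. ?form n F H S"
      if F: "spanning_subgraph F (complete_multipartite r n)"
        "free_of F (disjoint_copies k (complete_graph t))" "card (edges F) = ?ex n" for F
    proof -
      have "extremal ?V fst t (Suc (k - 1)) (arcs F)" using extremal_arcs[OF t k F] k by simp
      then obtain S where S: "S \<subseteq> ?V" "card S = k - 1" "colorable (t - 1) (?V - S) (arcs F)"
        using N[rule_format, OF finV r big] by blast
      from add_incident_edges_of_colorable[OF t k F S] S(1,2) show ?thesis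
        unfolding verts_host by blast
    qed
    show "?ex n = g_num r n k t \<and> (\<forall>F. ?extr n F \<longrightarrow> (\<exists>H S. ?form n F H S))"
    proof (intro conjI allI impI)
      show "?ex n = g_num r n k t" by (rule ex_num_eq_g_num[OF t k found])
      fix F assume F: "?extr n F"
      show "\<exists>H S. ?form n F H S" by (rule found) (use F in blast)+
    qed
  qed
qed

end
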